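(* Let $X$ be a separable Hilbert space and let $A:D(A)\subset X\to X$ be a densely defined linear operator such that: (a) $A$ is self-adjoint; (b) $A$ is accretive, i.e. $\langle Ax,x\rangle\ge 0$ for all $x\in D(A)$; (c) there exists $\lambda>0$ such that $(\lambda I+A)^{-1}:X\to X$ is compact. Let $\{\lambda_k\}_{k\in\mathbb{N}^*}$ be the eigenvalues of $A$ and $\{\varphi_k\}_{k\in\mathbb{N}^*}$ the corresponding eigenfunctions, and suppose that there exists $\alpha>0$ such that $\sqrt{\lambda_{k+1}}-\sqrt{\lambda_k}\ge\alpha$ for all $k\in\mathbb{N}^*$. Let $B:X\to X$ be a bounded linear operator for which there exist $b,q>0$ such that $\langle B\varphi_1,\varphi_1\rangle\ne0$ and $\lambda_k^q|\langle B\varphi_1,\varphi_k\rangle|\ge b$ for all $k>1$. Then there exists a constant $r_1>0$ such that for any $R>0$ there exists $T_R>0$ such that for all $u_0\in X$ satisfying $$|\langle u_0,\varphi_1\rangle-1|<r_1\quad\text{and}\quad\|u_0-\langle u_0,\varphi_1\rangle\varphi_1\|\le R,$$ there exists a control $p\in L^2(0,T_R)$ such that the mild solution $u$ of $$u'(t)+Au(t)+p(t)Bu(t)=0,\quad t\in[0,T_R],\qquad u(0)=u_0,$$ satisfies $u(T_R)=\psi_1(T_R)$, where $\psi_1(t)=e^{-\lambda_1t}\varphi_1$ is the ground state solution.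
   Context: $\mathbb{N}^*=\{1,2,\dots\}$. $X$ is infinite-dimensional; the eigenvalues are listed in increasing order and the eigenfunctions $\{\varphi_k\}_{k\in\mathbb{N}^*}$ form an orthonormal basis of $X$ with $A\varphi_k=\lambda_k\varphi_k$. The control $p$ is a scalar function of time (with values in the scalar field of $X$). The mild solution on $[0,T]$ of the control problem is the unique $u\in C([0,T];X)$ with $u(t)=e^{-tA}u_0-\int_0^te^{-(t-s)A}p(s)Bu(s)\,ds$ for all $t\in[0,T]$. *)

theory Defs
  imports "HOL-Analysis.Analysis"
begin

text \<open>
  Separable Hilbert spaces over the scalar field K, where K is the real or the complex field, seen
  as a subset of the complex numbers so that both cases are treated at once. Separability is the
  class \<^class>\<open>second_countable_topology\<close>, completeness is part of \<^class>\<open>banach\<close>. Only the values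
  scl c x with c in K are meaningful. The scalar product ip is K-valued, linear in its
  first argument and conjugate linear in its second one, and induces the norm; by polarization the
  inner product of the class \<^class>\<open>real_inner\<close> is then the real part of ip.
\<close>

locale separable_hilbert_space =
  fixes K :: "complex set"
    and scl :: "complex \<Rightarrow> 'a::{real_inner, banach, second_countable_topology} \<Rightarrow> 'a"
    and ip :: "'a \<Rightarrow> 'a \<Rightarrow> complex"
  assumes scalar_field: "K = \<real> \<or> K = UNIV"
    and scl_add_right: "c \<in> K \<Longrightarrow> scl c (x + y) = scl c x + scl c y"
    and scl_add_left: "c \<in> K \<Longrightarrow> d \<in> K \<Longrightarrow> scl (c + d) x = scl c x + scl d x"
    and scl_scl: "c \<in> K \<Longrightarrow> d \<in> K \<Longrightarrow> scl c (scl d x) = scl (c * d) x"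
    and scl_of_real: "scl (of_real r) x = r *\<^sub>R x"
    and ip_in_K: "ip x y \<in> K"
    and ip_add_left: "ip (x + y) z = ip x z + ip y z"
    and ip_scl_left: "c \<in> K \<Longrightarrow> ip (scl c x) y = c * ip x y"
    and ip_cnj: "ip y x = cnj (ip x y)"
    and ip_self: "ip x x = of_real ((norm x)\<^sup>2)"

lemma separable_hilbert_space_real:
  "separable_hilbert_space \<real> (\<lambda>c x. Re c *\<^sub>R x)
     (\<lambda>x y :: 'a::{real_inner, banach, second_countable_topology}. of_real (x \<bullet> y))"
  by unfold_locales
    (auto simp: algebra_simps inner_commute power2_norm_eq_inner Reals_def)

lemma separable_hilbert_space_complex:
  "separable_hilbert_space UNIV (*) (\<lambda>x y :: complex. x * cnj y)"
  by unfold_locales (auto simp: algebra_simps scaleR_conv_of_real simp flip: complex_norm_square)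

definition orthonormal_basis ::
    "(complex \<Rightarrow> 'a::real_normed_vector \<Rightarrow> 'a) \<Rightarrow> ('a \<Rightarrow> 'a \<Rightarrow> complex) \<Rightarrow> ('i \<Rightarrow> 'a) \<Rightarrow> 'i set \<Rightarrow> bool"
  where "orthonormal_basis scl ip \<phi> I \<longleftrightarrow>
    (\<forall>j\<in>I. \<forall>k\<in>I. ip (\<phi> j) (\<phi> k) = (if j = k then 1 else 0)) \<and>
    (\<forall>x. ((\<lambda>k. scl (ip x (\<phi> k)) (\<phi> k)) has_sum x) I)"

text \<open>An unbounded operator is given by its domain D and a function A of which only the values
  on D matter.\<close>

definition linear_operator_on ::
    "complex set \<Rightarrow> (complex \<Rightarrow> 'a::real_normed_vector \<Rightarrow> 'a) \<Rightarrow> 'a set \<Rightarrow> ('a \<Rightarrow> 'a) \<Rightarrow> bool"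
  where "linear_operator_on K scl D A \<longleftrightarrow>
    0 \<in> D \<and>
    (\<forall>x\<in>D. \<forall>y\<in>D. x + y \<in> D \<and> A (x + y) = A x + A y) \<and>
    (\<forall>c\<in>K. \<forall>x\<in>D. scl c x \<in> D \<and> A (scl c x) = scl c (A x))"

definition densely_defined :: "'a::topological_space set \<Rightarrow> bool"
  where "densely_defined D \<longleftrightarrow> closure D = UNIV"

definition operator_graph :: "'a set \<Rightarrow> ('a \<Rightarrow> 'a) \<Rightarrow> ('a \<times> 'a) set"
  where "operator_graph D A = {(x, A x) | x. x \<in> D}"

definition adjoint_graph ::
    "('a \<Rightarrow> 'a \<Rightarrow> complex) \<Rightarrow> 'a set \<Rightarrow> ('a \<Rightarrow> 'a) \<Rightarrow> ('a \<times> 'a) set"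
  where "adjoint_graph ip D A = {(y, z). \<forall>x\<in>D. ip (A x) y = ip x z}"

definition self_adjoint :: "('a \<Rightarrow> 'a \<Rightarrow> complex) \<Rightarrow> 'a set \<Rightarrow> ('a \<Rightarrow> 'a) \<Rightarrow> bool"
  where "self_adjoint ip D A \<longleftrightarrow> adjoint_graph ip D A = operator_graph D A"

definition accretive :: "('a \<Rightarrow> 'a \<Rightarrow> complex) \<Rightarrow> 'a set \<Rightarrow> ('a \<Rightarrow> 'a) \<Rightarrow> bool"
  where "accretive ip D A \<longleftrightarrow> (\<forall>x\<in>D. ip (A x) x \<in> \<real>\<^sub>\<ge>\<^sub>0)"

definition bounded_operator ::
    "complex set \<Rightarrow> (complex \<Rightarrow> 'a::real_normed_vector \<Rightarrow> 'a) \<Rightarrow> ('a \<Rightarrow> 'a) \<Rightarrow> bool"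
  where "bounded_operator K scl T \<longleftrightarrow>
    bounded_linear T \<and> (\<forall>c\<in>K. \<forall>x. T (scl c x) = scl c (T x))"

definition compact_operator ::
    "complex set \<Rightarrow> (complex \<Rightarrow> 'a::real_normed_vector \<Rightarrow> 'a) \<Rightarrow> ('a \<Rightarrow> 'a) \<Rightarrow> bool"
  where "compact_operator K scl T \<longleftrightarrow>
    bounded_operator K scl T \<and> (\<forall>S. bounded S \<longrightarrow> compact (closure (T ` S)))"

definition has_compact_resolvent ::
    "complex set \<Rightarrow> (complex \<Rightarrow> 'a::real_normed_vector \<Rightarrow> 'a) \<Rightarrow> 'a set \<Rightarrow> ('a \<Rightarrow> 'a) \<Rightarrow> bool"
  where "has_compact_resolvent K scl D A \<longleftrightarrow>
    (\<exists>\<mu>>0. bij_betw (\<lambda>x. \<mu> *\<^sub>R x + A x) D UNIV \<and>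
       compact_operator K scl (inv_into D (\<lambda>x. \<mu> *\<^sub>R x + A x)))"

definition C0_semigroup ::
    "complex set \<Rightarrow> (complex \<Rightarrow> 'a::real_normed_vector \<Rightarrow> 'a) \<Rightarrow> (real \<Rightarrow> 'a \<Rightarrow> 'a) \<Rightarrow> bool"
  where "C0_semigroup K scl S \<longleftrightarrow>
    (\<forall>t\<ge>0. bounded_operator K scl (S t)) \<and>
    (\<forall>x. S 0 x = x) \<and>
    (\<forall>s\<ge>0. \<forall>t\<ge>0. \<forall>x. S (s + t) x = S s (S t x)) \<and>
    (\<forall>x. ((\<lambda>t. S t x) \<longlongrightarrow> x) (at_right 0))"

definition generator_graph :: "(real \<Rightarrow> 'a::real_normed_vector \<Rightarrow> 'a) \<Rightarrow> ('a \<times> 'a) set"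
  where "generator_graph S = {(x, y). ((\<lambda>h. (S h x - x) /\<^sub>R h) \<longlongrightarrow> y) (at_right 0)}"

text \<open>The semigroup of operators exp(-tA), that is, the strongly continuous semigroup generated
  by -A. It exists for nonnegative self-adjoint A, and its values for nonnegative t are uniquely
  determined; those for negative t are irrelevant.\<close>

definition exp_neg ::
    "complex set \<Rightarrow> (complex \<Rightarrow> 'a::real_normed_vector \<Rightarrow> 'a) \<Rightarrow> 'a set \<Rightarrow> ('a \<Rightarrow> 'a) \<Rightarrow> real \<Rightarrow> 'a \<Rightarrow> 'a"
  where "exp_neg K scl D A =
    (SOME S. C0_semigroup K scl S \<and> generator_graph S = operator_graph D (\<lambda>x. - A x))"

definition square_integrable_on :: "complex set \<Rightarrow> real \<Rightarrow> (real \<Rightarrow> complex) \<Rightarrow> bool"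
  where "square_integrable_on K T p \<longleftrightarrow>
    (\<forall>t. p t \<in> K) \<and>
    set_borel_measurable lborel {0<..<T} p \<and>
    set_integrable lborel {0<..<T} (\<lambda>t. (norm (p t))\<^sup>2)"

text \<open>The equation satisfied by a mild solution of u' + A u + p B u = 0 with u(0) = u0, where S is
  the semigroup exp(-tA). Integrability is required explicitly because the Bochner integral of a
  non-integrable function is 0 by convention.\<close>

definition mild_equation ::
    "(complex \<Rightarrow> 'a::{banach, second_countable_topology} \<Rightarrow> 'a) \<Rightarrow> (real \<Rightarrow> 'a \<Rightarrow> 'a) \<Rightarrow> ('a \<Rightarrow> 'a) \<Rightarrow>
      (real \<Rightarrow> complex) \<Rightarrow> real \<Rightarrow> 'a \<Rightarrow> (real \<Rightarrow> 'a) \<Rightarrow> bool"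
  where "mild_equation scl S B p T u0 u \<longleftrightarrow>
    continuous_on {0..T} u \<and>
    (\<forall>t\<in>{0..T}.
       set_integrable lborel {0<..<t} (\<lambda>s. S (t - s) (scl (p s) (B (u s)))) \<and>
       u t = S t u0 - (LBINT s:{0<..<t}. S (t - s) (scl (p s) (B (u s)))))"

definition mild_solution ::
    "(complex \<Rightarrow> 'a::{banach, second_countable_topology} \<Rightarrow> 'a) \<Rightarrow> (real \<Rightarrow> 'a \<Rightarrow> 'a) \<Rightarrow> ('a \<Rightarrow> 'a) \<Rightarrow>
      (real \<Rightarrow> complex) \<Rightarrow> real \<Rightarrow> 'a \<Rightarrow> (real \<Rightarrow> 'a) \<Rightarrow> bool"
  where "mild_solution scl S B p T u0 u \<longleftrightarrow>
    mild_equation scl S B p T u0 u \<and>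
    (\<forall>v. mild_equation scl S B p T u0 v \<longrightarrow> (\<forall>t\<in>{0..T}. v t = u t))"

definition ground_state :: "(nat \<Rightarrow> real) \<Rightarrow> (nat \<Rightarrow> 'a::real_vector) \<Rightarrow> real \<Rightarrow> 'a"
  where "ground_state lam \<phi> t = exp (- lam 1 * t) *\<^sub>R \<phi> 1"

end

theory Submission
  imports Defs "HOL-Real_Asymp.Real_Asymp"
begin

text \<open>
  Write e_k for the eigenfunction of index k + 1 and \<mu>_k for the difference of its eigenvalue with the
  first one. Multiplying the solution by exp(lam 1 t) replaces the eigenvalues by the rates \<mu>_k, and
  the ground state by the stationary state e_0. The gap condition on the square roots gives
  \<mu>_k \<ge> \<alpha>^2 k^2 and separates the rates by at least \<alpha>^2. Without control the component along e_0 is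
  constant and the others decay, so that after a long time every initial state that the theorem admits
  is as close to e_0 as desired. It remains to steer states close to e_0 exactly to e_0, on intervals
  of finite total length.

  This is done in infinitely many stages. Linearized at e_0, the equation is forced by p(t) B e_0, and
  the coefficient of e_k can be brought to 0 by prescribing the moment of p against exp(\<mu>_k s). In each
  stage only the first N modes are treated. If p is constant on N consecutive intervals of length \<delta>,
  its moments are values of a polynomial at the nodes exp(\<mu>_k \<delta>), so that Lagrange interpolation
  provides p; as the nodes are separated relative to their size, its norm is at most of order (C/\<delta>)^N
  times powers of N and 1/\<delta>, relative to the initial deviation (low_modes_controllable). In the second
  half of the stage the control is switched off and the remaining modes decay at the large rate
  \<alpha>^2 N^2. The nonlinear error is quadratic in the deviation (control_step).

  Crude bounds suffice because of the freedom in the parameters. Stage j has length 1 / (j (j + 1)),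
  treats N = j^4 modes and starts at distance at most exp(-j^6) from e_0. The cost is then exp(O(j^4 ln j)),
  the decay of the high modes is exp(-c j^6), and the squared distance exp(-2 j^6) leaves room for
  the square of the cost; so the next stage starts at distance at most exp(-(j + 1)^6) if j is large
  (control_schedule). All these controls are bounded by 1, hence so is their concatenation. Its mild
  solution exists up to and including the final time and is continuous there, so it ends in e_0
  (steer_by_concatenation).

  The semigroup exp(-tA) is given only by its generator. The diagonal semigroup has this generator
  because A is self-adjoint, and every semigroup with this generator acts on eigenvectors by
  exponentials, because its operators are bounded uniformly for small times; hence it is the diagonal one
  (exp_neg_eq_semigroup).
\<close>

section \<open>Scalar products and orthonormal expansions\<close>

context separable_hilbert_space
begin

lemma K_real [simp, intro]: "complex_of_real r \<in> K"
  using scalar_field by auto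

lemma K_mult [intro]: "c \<in> K \<Longrightarrow> d \<in> K \<Longrightarrow> c * d \<in> K"
  and K_diff [intro]: "c \<in> K \<Longrightarrow> d \<in> K \<Longrightarrow> c - d \<in> K"
  and K_divide [intro]: "c \<in> K \<Longrightarrow> d \<in> K \<Longrightarrow> c / d \<in> K"
  and K_cnj [intro]: "c \<in> K \<Longrightarrow> cnj c \<in> K"
  using scalar_field by (auto simp: Reals_cnj_iff)

lemma K_0 [simp, intro]: "0 \<in> K" and K_1 [simp, intro]: "1 \<in> K"
  using scalar_field by auto

lemma K_sum [intro]: "(\<And>i. i \<in> I \<Longrightarrow> f i \<in> K) \<Longrightarrow> sum f I \<in> K"
  using scalar_field by auto

lemma scl_0_left [simp]: "scl 0 x = 0"
  using scl_of_real[of 0 x] by simp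

lemma scl_1 [simp]: "scl 1 x = x"
  using scl_of_real[of 1 x] by simp

lemma scl_scaleR: "c \<in> K \<Longrightarrow> scl c (r *\<^sub>R x) = r *\<^sub>R scl c x"
  by (metis K_real mult.commute scl_of_real scl_scl)

lemma scl_of_real_mult: "c \<in> K \<Longrightarrow> scl (of_real r * c) x = r *\<^sub>R scl c x"
  by (metis K_real scl_of_real scl_scl)

lemma scl_diff_left: "c \<in> K \<Longrightarrow> d \<in> K \<Longrightarrow> scl (c - d) x = scl c x - scl d x"
  by (metis (no_types, lifting) K_diff add_diff_cancel_right' diff_add_cancel scl_add_left)

lemma ip_add_right: "ip x (y + z) = ip x y + ip x z"
  by (metis complex_cnj_add ip_add_left ip_cnj)

lemma ip_scl_right: "c \<in> K \<Longrightarrow> ip x (scl c y) = cnj c * ip x y"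
  by (metis complex_cnj_mult ip_cnj ip_scl_left)

lemma ip_scaleR_left: "ip (r *\<^sub>R x) y = of_real r * ip x y"
  by (metis K_real ip_scl_left scl_of_real)

lemma ip_scaleR_right: "ip x (r *\<^sub>R y) = of_real r * ip x y"
  by (metis K_real complex_cnj_complex_of_real ip_scl_right scl_of_real)

lemma Re_ip: "Re (ip x y) = x \<bullet> y"
proof -
  have "ip (x + y) (x + y) = ip x x + ip x y + cnj (ip x y) + ip y y"
    by (simp add: ip_add_left ip_add_right ip_cnj[of y x])
  then have "of_real ((norm (x + y))\<^sup>2) =
      of_real ((norm x)\<^sup>2) + (ip x y + cnj (ip x y)) + of_real ((norm y)\<^sup>2)"
    unfolding ip_self by simp
  from arg_cong[OF this, of Re]
  have "(norm (x + y))\<^sup>2 = (norm x)\<^sup>2 + 2 * Re (ip x y) + (norm y)\<^sup>2"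
    by (simp del: of_real_power)
  then show ?thesis
    by (simp add: power2_norm_eq_inner inner_commute algebra_simps)
qed

lemma norm_scl: assumes "c \<in> K" shows "norm (scl c x) = norm c * norm x"
proof -
  have "ip (scl c x) (scl c x) = (c * cnj c) * ip x x"
    using assms by (simp add: ip_scl_left ip_scl_right)
  then have "complex_of_real ((norm (scl c x))\<^sup>2) = of_real ((norm c)\<^sup>2 * (norm x)\<^sup>2)"
    unfolding ip_self complex_norm_square[symmetric] by simp
  then have "(norm (scl c x))\<^sup>2 = (norm c)\<^sup>2 * (norm x)\<^sup>2"
    using of_real_eq_iff by blast
  then show ?thesis by (metis norm_ge_zero norm_mult power2_eq_iff_nonneg power_mult_distrib mult_nonneg_nonneg)
qed

text \<open>Rotating the first argument by a unimodular scalar turns the scalar product into its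
  modulus, and reduces its Cauchy-Schwarz inequality to that of the real inner product.\<close>

lemma norm_ip_le: "norm (ip x y) \<le> norm x * norm y"
proof (cases "ip x y = 0")
  case False
  define c where "c = cnj (ip x y) / of_real (norm (ip x y))"
  have c: "c \<in> K" unfolding c_def using ip_in_K by blast
  have nc: "norm c = 1" unfolding c_def using False by (simp add: norm_divide)
  have "c * ip x y = of_real (norm (ip x y))"
    unfolding c_def using False by (simp add: complex_norm_square[symmetric] field_simps power2_eq_square)
  then have "norm (ip x y) = Re (ip (scl c x) y)"
    by (simp add: ip_scl_left c)
  also have "\<dots> \<le> norm (scl c x) * norm y"
    unfolding Re_ip by (rule norm_cauchy_schwarz)
  also have "\<dots> = norm x * norm y" by (simp add: norm_scl c nc)
  finally show ?thesis .
qed auto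

lemma bounded_linear_ip_left: "bounded_linear (\<lambda>x. ip x y)"
  by (rule bounded_linear_intro[where K = "norm y"])
     (auto simp: ip_add_left ip_scaleR_left norm_ip_le scaleR_conv_of_real)

lemma bounded_linear_ip_right: "bounded_linear (\<lambda>x. ip y x)"
  by (rule bounded_linear_intro[where K = "norm y"])
     (auto simp: ip_add_right ip_scaleR_right scaleR_conv_of_real mult.commute[of _ "norm y"] norm_ip_le)

lemma bounded_linear_scl: "c \<in> K \<Longrightarrow> bounded_linear (scl c)"
  by (rule bounded_linear_intro[where K = "norm c"])
     (auto simp: scl_add_right scl_scaleR norm_scl)

lemmas ip_diff_left = linear_diff[OF bounded_linear.linear[OF bounded_linear_ip_left]]
lemmas ip_minus_left = linear_neg[OF bounded_linear.linear[OF bounded_linear_ip_left]]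
lemmas ip_0_left [simp] = linear_0[OF bounded_linear.linear[OF bounded_linear_ip_left]]
lemmas ip_sum_left = linear_sum[OF bounded_linear.linear[OF bounded_linear_ip_left]]

text \<open>Scalar multiplication is not assumed to be meaningful off the scalar field. Writing it in terms
  of real and imaginary parts yields an operation that is bilinear over the reals and agrees with
  scl on the scalar field, so that measurability and continuity results apply.\<close>

definition rotate :: "'a \<Rightarrow> 'a"
  where "rotate x = (if K = UNIV then scl \<i> x else 0)"

lemma bounded_linear_rotate: "bounded_linear rotate"
  unfolding rotate_def by (cases "K = UNIV") (auto intro: bounded_linear_scl simp: bounded_linear_zero)

lemma scl_conv_rotate: assumes "c \<in> K" shows "scl c x = Re c *\<^sub>R x + Im c *\<^sub>R rotate x"
proof (cases "K = UNIV")
  case True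
  have "scl (of_real (Re c) + of_real (Im c) * \<i>) x = Re c *\<^sub>R x + Im c *\<^sub>R scl \<i> x"
    using True by (simp add: scl_add_left scl_of_real scl_of_real_mult)
  moreover have "of_real (Re c) + of_real (Im c) * \<i> = c"
    by (simp add: complex_eq_iff)
  ultimately show ?thesis unfolding rotate_def if_P[OF True] by simp
next
  case False
  then have "c \<in> \<real>" using assms scalar_field by auto
  then have "c = of_real (Re c)" by (simp add: complex_is_Real_iff complex_eq_iff)
  then have "scl c x = Re c *\<^sub>R x" and "Im c = 0" by (metis scl_of_real, metis Im_complex_of_real)
  then show ?thesis by simp
qed

lemma measurable_scl:
  assumes "\<And>s. p s \<in> K" "p \<in> borel_measurable M" "f \<in> borel_measurable M"
  shows "(\<lambda>s. scl (p s) (f s)) \<in> borel_measurable M"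
proof -
  have [measurable]: "rotate \<in> borel_measurable borel"
    by (rule borel_measurable_continuous_onI[OF linear_continuous_on[OF bounded_linear_rotate]])
  note assms(2,3)[measurable]
  have "(\<lambda>s. Re (p s) *\<^sub>R f s + Im (p s) *\<^sub>R rotate (f s)) \<in> borel_measurable M"
    by measurable
  then show ?thesis using assms(1) by (simp add: scl_conv_rotate)
qed

end

locale hilbert_basis = separable_hilbert_space K scl ip
  for K :: "complex set"
    and scl :: "complex \<Rightarrow> 'a::{real_inner, banach, second_countable_topology} \<Rightarrow> 'a"
    and ip :: "'a \<Rightarrow> 'a \<Rightarrow> complex" +
  fixes e :: "nat \<Rightarrow> 'a"
  assumes orthonormal: "ip (e j) (e k) = (if j = k then 1 else 0)"
    and expansion: "(\<lambda>k. scl (ip x (e k)) (e k)) sums x"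
begin

lemma norm_e [simp]: "norm (e k) = 1"
proof -
  have "complex_of_real ((norm (e k))\<^sup>2) = of_real 1" using ip_self[of "e k"] orthonormal[of k k] by simp
  then have "(norm (e k))\<^sup>2 = 1" using of_real_eq_iff by blast
  then show ?thesis by (simp add: power2_eq_1_iff) (metis norm_ge_zero not_one_le_zero neg_0_le_iff_le)
qed

lemma coeff_eqI: "(\<And>k. ip x (e k) = ip y (e k)) \<Longrightarrow> x = y"
  using expansion[of x] expansion[of y] sums_unique2 by fastforce

lemma ip_sums: "(\<lambda>k. ip x (e k) * cnj (ip y (e k))) sums ip x y"
proof -
  have "(\<lambda>k. ip (scl (ip x (e k)) (e k)) y) sums ip x y"
    by (rule bounded_linear.sums[OF bounded_linear_ip_left expansion])
  then show ?thesis by (simp add: ip_scl_left ip_in_K ip_cnj[of "e _" y])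
qed

lemma parseval: "(\<lambda>k. (norm (ip x (e k)))\<^sup>2) sums (norm x)\<^sup>2"
proof -
  have "(\<lambda>k. Re (ip x (e k) * cnj (ip x (e k)))) sums Re (ip x x)"
    by (rule sums_Re[OF ip_sums])
  then show ?thesis by (simp add: ip_self complex_norm_square[symmetric] flip: of_real_power)
qed

text \<open>All norm estimates for operators that act diagonally in the basis reduce, by Parseval, to this
  comparison of coefficients.\<close>

lemma norm_le_coeffs:
  assumes "C \<ge> 0" and le: "\<And>k. norm (ip y (e k)) \<le> C * norm (ip x (e k))"
  shows "norm y \<le> C * norm x"
proof -
  have "(norm y)\<^sup>2 \<le> C\<^sup>2 * (norm x)\<^sup>2"
  proof (rule sums_le[OF _ parseval sums_mult[OF parseval]])
    fix k show "(norm (ip y (e k)))\<^sup>2 \<le> C\<^sup>2 * (norm (ip x (e k)))\<^sup>2"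
      using power_mono[OF le norm_ge_zero, of k 2] by (simp add: power_mult_distrib)
  qed
  then show ?thesis
    using \<open>C \<ge> 0\<close> by (metis mult_nonneg_nonneg norm_ge_zero power2_le_imp_le power_mult_distrib)
qed

lemma norm_finite_sum:
  assumes "finite F" "\<And>k. c k \<in> K"
  shows "(norm (\<Sum>k\<in>F. scl (c k) (e k)))\<^sup>2 = (\<Sum>k\<in>F. (norm (c k))\<^sup>2)"
proof -
  let ?y = "\<Sum>k\<in>F. scl (c k) (e k)"
  have coeff: "ip ?y (e j) = (if j \<in> F then c j else 0)" for j
  proof -
    have "ip ?y (e j) = (\<Sum>k\<in>F. ip (scl (c k) (e k)) (e j))"
      by (rule ip_sum_left)
    also have "\<dots> = (\<Sum>k\<in>F. if k = j then c k else 0)"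
      by (rule sum.cong) (simp_all add: ip_scl_left assms orthonormal)
    finally show ?thesis using assms(1) by simp
  qed
  have "(\<lambda>k. if k \<in> F then (norm (c k))\<^sup>2 else 0) sums (\<Sum>k\<in>F. (norm (c k))\<^sup>2)"
    using sums_If_finite_set[OF assms(1), of "\<lambda>k. (norm (c k))\<^sup>2"] by simp
  moreover have "(\<lambda>k. if k \<in> F then (norm (c k))\<^sup>2 else 0) sums (norm ?y)\<^sup>2"
    using parseval[of ?y] unfolding coeff by (simp add: if_distrib[where f="\<lambda>x. (norm x)\<^sup>2"] cong: if_cong)
  ultimately show ?thesis by (rule sums_unique2[symmetric])
qed

lemma summable_orthogonal:
  assumes c: "\<And>k. c k \<in> K" and sq: "summable (\<lambda>k. (norm (c k))\<^sup>2)"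
  shows "summable (\<lambda>k. scl (c k) (e k))"
  unfolding summable_Cauchy
proof (intro allI impI)
  fix \<epsilon> :: real assume "\<epsilon> > 0"
  then have "\<epsilon>\<^sup>2 > 0" by simp
  then obtain N where N: "\<And>m n. m \<ge> N \<Longrightarrow> norm (\<Sum>k=m..<n. (norm (c k))\<^sup>2) < \<epsilon>\<^sup>2"
    using sq unfolding summable_Cauchy by blast
  have "norm (\<Sum>k=m..<n. scl (c k) (e k)) < \<epsilon>" if "m \<ge> N" for m n
  proof -
    have "(norm (\<Sum>k=m..<n. scl (c k) (e k)))\<^sup>2 < \<epsilon>\<^sup>2"
      using N[OF that, of n] c by (simp add: norm_finite_sum)
    then show ?thesis using \<open>\<epsilon> > 0\<close> by (simp add: power2_less_imp_less)
  qed
  then show "\<exists>N. \<forall>m\<ge>N. \<forall>n. norm (\<Sum>k=m..<n. scl (c k) (e k)) < \<epsilon>" by blast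
qed

lemma coeff_suminf:
  assumes c: "\<And>k. c k \<in> K" and sq: "summable (\<lambda>k. (norm (c k))\<^sup>2)"
  shows "ip (\<Sum>k. scl (c k) (e k)) (e j) = c j"
proof -
  have "(\<lambda>k. ip (scl (c k) (e k)) (e j)) sums ip (\<Sum>k. scl (c k) (e k)) (e j)"
    by (rule bounded_linear.sums[OF bounded_linear_ip_left summable_sums[OF summable_orthogonal[OF assms]]])
  moreover have "(\<lambda>k. ip (scl (c k) (e k)) (e j)) = (\<lambda>k. if k = j then c k else 0)"
    by (auto simp: ip_scl_left c orthonormal)
  ultimately show ?thesis using sums_unique2[OF _ sums_single[of j c]] by simp
qed

subsection \<open>Diagonal operators\<close>

text \<open>Meaningful for bounded multipliers, for which the series converges.\<close>

definition diag :: "(nat \<Rightarrow> real) \<Rightarrow> 'a \<Rightarrow> 'a"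
  where "diag m x = (\<Sum>k. scl (of_real (m k) * ip x (e k)) (e k))"

lemma coeff_diag:
  assumes "\<And>k. \<bar>m k\<bar> \<le> C"
  shows "ip (diag m x) (e k) = of_real (m k) * ip x (e k)"
  unfolding diag_def
proof (rule coeff_suminf)
  show "of_real (m k) * ip x (e k) \<in> K" for k using ip_in_K by blast
  show "summable (\<lambda>k. (norm (complex_of_real (m k) * ip x (e k)))\<^sup>2)"
  proof (rule summable_comparison_test'[where N = 0])
    show "summable (\<lambda>k. C\<^sup>2 * (norm (ip x (e k)))\<^sup>2)"
      by (rule summable_mult[OF sums_summable[OF parseval]])
    show "norm ((norm (complex_of_real (m k) * ip x (e k)))\<^sup>2) \<le> C\<^sup>2 * (norm (ip x (e k)))\<^sup>2" for k
      using power_mono[OF assms[of k] abs_ge_zero, of 2]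
      by (simp add: norm_mult power_mult_distrib mult_right_mono)
  qed
qed

lemma bounded_linear_diag:
  assumes m: "\<And>k. \<bar>m k\<bar> \<le> C"
  shows "bounded_linear (diag m)"
    and "norm (diag m x) \<le> C * norm x"
proof -
  have C: "C \<ge> 0" using m[of 0] by linarith
  show n: "norm (diag m x) \<le> C * norm x" for x
    by (rule norm_le_coeffs[OF C])
       (simp add: coeff_diag[of m, OF m] norm_mult m mult_right_mono)
  show "bounded_linear (diag m)"
  proof (rule bounded_linear_intro[where K = C])
    show "diag m (x + y) = diag m x + diag m y" for x y
      by (rule coeff_eqI) (simp add: coeff_diag[of m, OF m] ip_add_left algebra_simps)
    show "diag m (r *\<^sub>R x) = r *\<^sub>R diag m x" for r x
      by (rule coeff_eqI) (simp add: coeff_diag[of m, OF m] ip_scaleR_left algebra_simps)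
    show "norm (diag m x) \<le> norm x * C" for x using n[of x] by (simp add: mult.commute)
  qed
qed

text \<open>A bounded sequence of multipliers that converges pointwise gives strongly convergent diagonal
  operators: by Parseval the squared error is a series dominated by a multiple of the series of
  the norm, and Tannery's theorem applies.\<close>

lemma diag_tendsto:
  assumes m: "\<And>k. ((\<lambda>t. m t k) \<longlongrightarrow> l k) F"
    and bound: "eventually (\<lambda>t. \<forall>k. \<bar>m t k\<bar> \<le> C) F"
  shows "((\<lambda>t. diag (m t) x) \<longlongrightarrow> diag l x) F"
proof (cases "F = bot")
  case F: False
  have l: "\<bar>l k\<bar> \<le> C" for k
  proof (rule tendsto_upperbound[OF tendsto_rabs[OF m] _ F])
    show "eventually (\<lambda>t. \<bar>m t k\<bar> \<le> C) F" using bound by eventually_elim auto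
  qed
  let ?a = "\<lambda>k t. (\<bar>m t k - l k\<bar>)\<^sup>2 * (norm (ip x (e k)))\<^sup>2"
  have "((\<lambda>t. (\<Sum>k. ?a k t)) \<longlongrightarrow> (\<Sum>k. 0)) F"
  proof (rule tannerys_theorem[THEN conjunct2, THEN conjunct2])
    show "(?a k \<longlongrightarrow> 0) F" for k
      by (rule tendsto_eq_intros m refl | simp)+
    have "eventually (\<lambda>t. \<forall>k. norm (?a k t) \<le> (2 * C)\<^sup>2 * (norm (ip x (e k)))\<^sup>2) F"
      using bound
    proof eventually_elim
      case (elim t)
      show ?case
      proof
        fix k
        have "\<bar>m t k - l k\<bar> \<le> 2 * C" using elim[THEN spec, of k] l[of k] by linarith
        from power_mono[OF this abs_ge_zero, of 2]
        show "norm (?a k t) \<le> (2 * C)\<^sup>2 * (norm (ip x (e k)))\<^sup>2"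
          by (simp add: mult_right_mono)
      qed
    qed
    then show "eventually (\<lambda>(k, t). norm (?a k t) \<le> (2 * C)\<^sup>2 * (norm (ip x (e k)))\<^sup>2) (at_top \<times>\<^sub>F F)"
      unfolding eventually_prod_filter
      by (intro exI[of _ "\<lambda>_. True"] exI conjI) auto
    show "summable (\<lambda>k. (2 * C)\<^sup>2 * (norm (ip x (e k)))\<^sup>2)"
      by (rule summable_mult[OF sums_summable[OF parseval]])
  qed (use F in auto)
  moreover have "eventually (\<lambda>t. (\<Sum>k. ?a k t) = (norm (diag (m t) x - diag l x))\<^sup>2) F"
    using bound
  proof eventually_elim
    case (elim t)
    then have "?a k t = (norm (ip (diag (m t) x - diag l x) (e k)))\<^sup>2" for k
      by (simp add: ip_diff_left coeff_diag[of "m t" C] coeff_diag[of l C, OF l] norm_mult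
            power_mult_distrib flip: left_diff_distrib of_real_diff)
    then show ?case using sums_unique[OF parseval[of "diag (m t) x - diag l x"]] by simp
  qed
  ultimately have "((\<lambda>t. (norm (diag (m t) x - diag l x))\<^sup>2) \<longlongrightarrow> 0) F"
    by (simp add: filterlim_cong)
  then have "((\<lambda>t. sqrt ((norm (diag (m t) x - diag l x))\<^sup>2)) \<longlongrightarrow> sqrt 0) F"
    by (rule tendsto_real_sqrt)
  then have "((\<lambda>t. norm (diag (m t) x - diag l x)) \<longlongrightarrow> 0) F" by simp
  then show ?thesis by (simp add: tendsto_norm_zero_iff LIM_zero_iff)
qed simp

end

section \<open>The semigroup generated by a self-adjoint diagonal operator\<close>

context hilbert_basis
begin

definition semigroup :: "(nat \<Rightarrow> real) \<Rightarrow> real \<Rightarrow> 'a \<Rightarrow> 'a"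
  where "semigroup \<nu> t = diag (\<lambda>k. exp (- \<nu> k * t))"

context
  fixes \<nu> :: "nat \<Rightarrow> real"
  assumes rate_nonneg: "\<And>k. \<nu> k \<ge> 0"
begin

lemma exp_rate_le_1: "t \<ge> 0 \<Longrightarrow> \<bar>exp (- \<nu> k * t)\<bar> \<le> 1"
  using rate_nonneg[of k] by simp

lemma coeff_semigroup: "t \<ge> 0 \<Longrightarrow> ip (semigroup \<nu> t x) (e k) = of_real (exp (- \<nu> k * t)) * ip x (e k)"
  unfolding semigroup_def by (rule coeff_diag[OF exp_rate_le_1])

lemma bounded_linear_semigroup: "t \<ge> 0 \<Longrightarrow> bounded_linear (semigroup \<nu> t)"
  unfolding semigroup_def by (rule bounded_linear_diag[OF exp_rate_le_1])

lemma norm_semigroup_le: "t \<ge> 0 \<Longrightarrow> norm (semigroup \<nu> t x) \<le> norm x"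
  unfolding semigroup_def using bounded_linear_diag(2)[OF exp_rate_le_1] by simp

lemma semigroup_0: "semigroup \<nu> 0 x = x"
  by (rule coeff_eqI) (simp add: coeff_semigroup)

lemma semigroup_add: "s \<ge> 0 \<Longrightarrow> t \<ge> 0 \<Longrightarrow> semigroup \<nu> (s + t) x = semigroup \<nu> s (semigroup \<nu> t x)"
proof (rule coeff_eqI)
  fix k assume "s \<ge> 0" "t \<ge> 0"
  moreover have "exp (- \<nu> k * (s + t)) = exp (- \<nu> k * s) * exp (- \<nu> k * t)"
    by (simp flip: exp_add add: algebra_simps)
  ultimately show "ip (semigroup \<nu> (s + t) x) (e k) = ip (semigroup \<nu> s (semigroup \<nu> t x)) (e k)"
    by (simp add: coeff_semigroup)
qed

lemma semigroup_scl: "c \<in> K \<Longrightarrow> t \<ge> 0 \<Longrightarrow> semigroup \<nu> t (scl c x) = scl c (semigroup \<nu> t x)"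
  by (rule coeff_eqI) (simp add: coeff_semigroup ip_scl_left)

lemma continuous_on_semigroup: "continuous_on {0..} (\<lambda>t. semigroup \<nu> t x)"
  unfolding continuous_on_def semigroup_def
proof (intro ballI diag_tendsto)
  fix t :: real and k
  show "((\<lambda>t. exp (- \<nu> k * t)) \<longlongrightarrow> exp (- \<nu> k * t)) (at t within {0..})"
    by (intro tendsto_intros)
  show "\<forall>\<^sub>F t in at t within {0..}. \<forall>k. \<bar>exp (- \<nu> k * t)\<bar> \<le> 1"
    unfolding eventually_at_filter using exp_rate_le_1 by (intro always_eventually) auto
qed

lemma C0_semigroup_diagonal: "C0_semigroup K scl (semigroup \<nu>)"
  unfolding C0_semigroup_def bounded_operator_def
proof (intro conjI allI impI ballI)
  show "((\<lambda>t. semigroup \<nu> t x) \<longlongrightarrow> x) (at_right 0)" for x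
  proof -
    have "((\<lambda>t. semigroup \<nu> t x) \<longlongrightarrow> semigroup \<nu> 0 x) (at 0 within {0..})"
      using continuous_on_semigroup[of x] unfolding continuous_on_def by auto
    then show ?thesis
      unfolding semigroup_0 by (rule tendsto_within_subset) auto
  qed
qed (auto simp: bounded_linear_semigroup semigroup_0 semigroup_add semigroup_scl)

text \<open>Difference quotients of the semigroup are diagonal operators applied to the generator, with
  multipliers between 0 and 1 that tend to 1; hence every element of the domain of A lies in the
  domain of the generator. Conversely, passing to the limit in the coefficients shows that a
  generator pair lies in the graph of the adjoint of -A, which is where self-adjointness is used.\<close>

lemma generator_graph_diagonal:
  assumes sa: "self_adjoint ip D A" and eig: "\<And>k. e k \<in> D \<and> A (e k) = \<nu> k *\<^sub>R e k"
  shows "generator_graph (semigroup \<nu>) = operator_graph D (\<lambda>x. - A x)"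
proof -
  have graph_iff: "(y, z) \<in> operator_graph D A \<longleftrightarrow> (\<forall>x\<in>D. ip (A x) y = ip x z)" for y z
    using sa unfolding self_adjoint_def adjoint_graph_def by auto
  have coeff_A: "ip (A x) (e k) = of_real (\<nu> k) * ip x (e k)" if "x \<in> D" for x k
  proof -
    have "(e k, \<nu> k *\<^sub>R e k) \<in> operator_graph D A"
      using eig[of k] unfolding operator_graph_def by force
    then show ?thesis using that unfolding graph_iff by (simp add: ip_scaleR_right)
  qed
  show ?thesis
  proof (intro set_eqI iffI; clarify)
    fix x y assume "(x, y) \<in> generator_graph (semigroup \<nu>)"
    then have lim: "((\<lambda>h. (semigroup \<nu> h x - x) /\<^sub>R h) \<longlongrightarrow> y) (at_right 0)"
      unfolding generator_graph_def by simp
    have coeff_y: "ip y (e k) = - of_real (\<nu> k) * ip x (e k)" for k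
    proof (rule tendsto_unique[OF trivial_limit_at_right_real])
      show "((\<lambda>h. ip ((semigroup \<nu> h x - x) /\<^sub>R h) (e k)) \<longlongrightarrow> ip y (e k)) (at_right 0)"
        by (rule bounded_linear.tendsto[OF bounded_linear_ip_left lim])
      have "((\<lambda>h. (exp (- \<nu> k * h) - 1) / h) \<longlongrightarrow> - \<nu> k) (at_right 0)"
        by real_asymp
      then have "((\<lambda>h. of_real ((exp (- \<nu> k * h) - 1) / h) * ip x (e k)) \<longlongrightarrow> of_real (- \<nu> k) * ip x (e k))
          (at_right 0)" by (intro tendsto_intros)
      moreover have "\<forall>\<^sub>F h in at_right 0. of_real ((exp (- \<nu> k * h) - 1) / h) * ip x (e k) =
          ip ((semigroup \<nu> h x - x) /\<^sub>R h) (e k)"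
        using eventually_at_right_less[of 0]
      proof eventually_elim
        case (elim h)
        then show ?case
          by (simp add: ip_scaleR_left ip_diff_left coeff_semigroup field_simps)
      qed
      ultimately show "((\<lambda>h. ip ((semigroup \<nu> h x - x) /\<^sub>R h) (e k)) \<longlongrightarrow> - of_real (\<nu> k) * ip x (e k)) (at_right 0)"
        by (simp add: tendsto_cong)
    qed
    have "ip (A z) x = ip z (- y)" if "z \<in> D" for z
    proof (rule sums_unique2[OF ip_sums])
      have "(\<lambda>k. ip z (e k) * cnj (ip (- y) (e k))) = (\<lambda>k. ip (A z) (e k) * cnj (ip x (e k)))"
        by (simp add: ip_minus_left coeff_y coeff_A[OF that] mult_ac)
      then show "(\<lambda>k. ip (A z) (e k) * cnj (ip x (e k))) sums ip z (- y)"
        using ip_sums[of z "- y"] by simp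
    qed
    then have "(x, - y) \<in> operator_graph D A" unfolding graph_iff by blast
    then show "(x, y) \<in> operator_graph D (\<lambda>x. - A x)" unfolding operator_graph_def
      by clarsimp (metis minus_minus)
  next
    fix x y assume "(x, y) \<in> operator_graph D (\<lambda>x. - A x)"
    then have x: "x \<in> D" and y: "y = - A x" unfolding operator_graph_def by auto
    define m where "m h k = (if \<nu> k = 0 then 1 else (1 - exp (- \<nu> k * h)) / (\<nu> k * h))" for h k
    have m_bound: "\<bar>m h k\<bar> \<le> 1" if "h > 0" for h k
    proof (cases "\<nu> k = 0")
      case False
      with rate_nonneg[of k] have "\<nu> k * h > 0" using that by simp
      moreover have "1 - \<nu> k * h \<le> exp (- (\<nu> k * h))" using exp_ge_add_one_self[of "- (\<nu> k * h)"] by simp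
      moreover have "exp (- (\<nu> k * h)) \<le> 1" using \<open>\<nu> k * h > 0\<close> by simp
      ultimately show ?thesis using False unfolding m_def by (simp add: field_simps)
    qed (simp add: m_def)
    have "((\<lambda>h. diag (m h) y) \<longlongrightarrow> diag (\<lambda>_. 1) y) (at_right 0)"
    proof (rule diag_tendsto)
      show "\<forall>\<^sub>F h in at_right 0. \<forall>k. \<bar>m h k\<bar> \<le> 1"
        using eventually_at_right_less[of 0] by eventually_elim (simp add: m_bound)
      show "((\<lambda>h. m h k) \<longlongrightarrow> 1) (at_right 0)" for k
      proof (cases "\<nu> k = 0")
        case False
        with rate_nonneg[of k] have "\<nu> k > 0" by simp
        then have "((\<lambda>h. (1 - exp (- \<nu> k * h)) / (\<nu> k * h)) \<longlongrightarrow> 1) (at_right 0)"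
          by real_asymp
        then show ?thesis using False by (simp add: m_def)
      qed (simp add: m_def)
    qed
    moreover have "diag (\<lambda>_. 1) y = y"
      by (rule coeff_eqI) (simp add: coeff_diag[of "\<lambda>_. 1" 1])
    moreover have "\<forall>\<^sub>F h in at_right 0. diag (m h) y = (semigroup \<nu> h x - x) /\<^sub>R h"
      using eventually_at_right_less[of 0]
    proof eventually_elim
      case (elim h)
      show ?case
      proof (rule coeff_eqI)
        fix k
        show "ip (diag (m h) y) (e k) = ip ((semigroup \<nu> h x - x) /\<^sub>R h) (e k)"
          using elim
          by (simp add: coeff_diag[of "m h", OF m_bound[OF elim]] y ip_minus_left coeff_A[OF x]
              ip_scaleR_left ip_diff_left coeff_semigroup m_def)
             (simp add: field_simps)
      qed
    qed
    ultimately show "(x, y) \<in> generator_graph (semigroup \<nu>)"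
      unfolding generator_graph_def by (simp add: tendsto_cong)
  qed
qed

end
end

subsection \<open>Uniqueness\<close>

text \<open>Baire's theorem: one of the closed sets on which all operators are bounded by a given number
  has an interior point.\<close>

lemma uniform_boundedness:
  fixes T :: "nat \<Rightarrow> 'a::banach \<Rightarrow> 'b::real_normed_vector"
  assumes lin: "\<And>n. bounded_linear (T n)" and bdd: "\<And>x. bounded (range (\<lambda>n. T n x))"
  obtains C where "\<And>n x. norm (T n x) \<le> C * norm x"
proof -
  define F where "F m = {x. \<forall>n. norm (T n x) \<le> real m}" for m :: nat
  have closed: "closed (F m)" for m
  proof -
    have "F m = (\<Inter>n. {x. norm (T n x) \<le> real m})" unfolding F_def by auto
    moreover have "closed {x. norm (T n x) \<le> real m}" for n
      by (intro closed_Collect_le continuous_intros linear_continuous_on lin)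
    ultimately show ?thesis by auto
  qed
  have cover: "(\<Union>m. F m) = UNIV"
  proof -
    have "x \<in> (\<Union>m. F m)" for x
    proof -
      obtain B where B: "\<And>n. norm (T n x) \<le> B" using bdd[of x] unfolding bounded_iff by auto
      obtain m where "B \<le> real m" using real_arch_simple by blast
      then have "x \<in> F m" unfolding F_def using B order_trans by blast
      then show ?thesis by blast
    qed
    then show ?thesis by blast
  qed
  have "\<exists>m. interior (F m) \<noteq> {}"
  proof (rule ccontr)
    assume "\<not> ?thesis"
    then have "euclidean interior_of (\<Union>(range F)) = {}"
      using closed completely_metrizable_space_euclidean
      by (intro Baire_category_alt) auto
    then show False using cover by simp
  qed
  then obtain m x0 r where r: "r > 0" "cball x0 r \<subseteq> F m"
    by (metis all_not_in_conv mem_interior_cball)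
  have "norm (T n x) \<le> (2 * real m / r) * norm x" for n x
  proof (cases "x = 0")
    case True then show ?thesis using linear_0[OF bounded_linear.linear[OF lin]] by simp
  next
    case False
    define y where "y = (r / norm x) *\<^sub>R x"
    have "x0 + y \<in> F m" "x0 \<in> F m"
      using r(1) False by (auto intro!: r(2)[THEN subsetD] simp: y_def dist_norm)
    then have "norm (T n (x0 + y)) \<le> real m" "norm (T n x0) \<le> real m" unfolding F_def by auto
    moreover have "T n y = T n (x0 + y) - T n x0"
      by (simp add: linear_add[OF bounded_linear.linear[OF lin]])
    ultimately have "norm (T n y) \<le> 2 * real m"
      using norm_triangle_ineq4[of "T n (x0 + y)" "T n x0"] by simp
    moreover have "norm (T n y) = r / norm x * norm (T n x)"
      unfolding y_def using r(1) by (simp add: linear_scale[OF bounded_linear.linear[OF lin]])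
    ultimately show ?thesis using r(1) False by (simp add: field_simps)
  qed
  then show ?thesis using that by blast
qed

text \<open>Otherwise there are times t n tending to 0 at which the norm of the operator exceeds n, although
  S (t n) x tends to x for every x; this contradicts uniform boundedness.\<close>

lemma C0_semigroup_bounded_near_0:
  fixes S :: "real \<Rightarrow> 'a::banach \<Rightarrow> 'a"
  assumes S: "C0_semigroup K scl S"
  obtains \<delta> M where "\<delta> > 0" "M \<ge> 0" "\<And>t x. 0 \<le> t \<Longrightarrow> t \<le> \<delta> \<Longrightarrow> norm (S t x) \<le> M * norm x"
proof -
  have lin: "bounded_linear (S t)" if "t \<ge> 0" for t
    using S that unfolding C0_semigroup_def bounded_operator_def by auto
  have S0: "S 0 x = x" for x
    using S unfolding C0_semigroup_def by auto
  have "\<exists>n. \<forall>t x. 0 \<le> t \<longrightarrow> t \<le> inverse (real (Suc n)) \<longrightarrow> norm (S t x) \<le> real n * norm x"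
  proof (rule ccontr)
    assume "\<not> ?thesis"
    then have "\<forall>n. \<exists>t x. 0 \<le> t \<and> t \<le> inverse (real (Suc n)) \<and> norm (S t x) > real n * norm x"
      by (meson not_le)
    then obtain t x where t: "\<And>n. 0 \<le> t n" "\<And>n. t n \<le> inverse (real (Suc n))"
      and x: "\<And>n. norm (S (t n) (x n)) > real n * norm (x n)" by metis
    have t_lim: "t \<longlonglongrightarrow> 0"
      by (rule tendsto_sandwich[OF _ _ tendsto_const LIMSEQ_inverse_real_of_nat]) (use t in auto)
    have "bounded (range (\<lambda>n. S (t n) y))" for y
    proof -
      have "((\<lambda>t. S t y) \<longlongrightarrow> y) (at_right 0)"
        using S unfolding C0_semigroup_def by auto
      then have "\<forall>\<^sub>F t in at_right 0. dist (S t y) y < 1" by (rule tendstoD) simp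
      then obtain d where d: "d > 0" "\<And>t. 0 < t \<Longrightarrow> t < d \<Longrightarrow> dist (S t y) y < 1"
        unfolding eventually_at_right_field by auto
      have "norm (S t y) \<le> norm y + 1" if "0 \<le> t" "t < d" for t
      proof (cases "t = 0")
        case False
        with d(2)[of t] that have "norm (S t y - y) < 1" by (simp add: dist_norm)
        then show ?thesis using norm_triangle_ineq2[of "S t y" y] by simp
      qed (simp add: S0)
      moreover have "\<forall>\<^sub>F n in sequentially. t n < d"
        using order_tendstoD(2)[OF t_lim d(1)] .
      ultimately have "\<forall>\<^sub>F n in sequentially. norm (S (t n) y) \<le> norm y + 1"
        by (auto elim!: eventually_mono simp: t)
      then have "Bseq (\<lambda>n. S (t n) y)" by (rule BfunI)
      then show ?thesis by (simp add: Bseq_eq_bounded)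
    qed
    then obtain C where C: "\<And>n x. norm (S (t n) x) \<le> C * norm x"
      using uniform_boundedness[of "\<lambda>n. S (t n)"] lin t(1) by metis
    obtain n where "C \<le> real n" using real_arch_simple by blast
    then have "C * norm (x n) \<le> real n * norm (x n)" by (simp add: mult_right_mono)
    then show False using C[of n "x n"] x[of n] by linarith
  qed
  then obtain n where "\<And>t x. 0 \<le> t \<Longrightarrow> t \<le> inverse (real (Suc n)) \<Longrightarrow> norm (S t x) \<le> real n * norm x"
    by blast
  then show ?thesis using that[of "inverse (real (Suc n))" "real n"] by auto
qed

text \<open>An eigenvector of the generator evolves exponentially. For small times, telescoping over n steps
  of length t/n bounds the deviation by a multiple of t times the error of the difference
  quotient, which vanishes in the limit; the semigroup law carries the identity to all times.\<close>

lemma C0_semigroup_eigenvector: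
  fixes S :: "real \<Rightarrow> 'a::banach \<Rightarrow> 'a"
  assumes S: "C0_semigroup K scl S" and gen: "(x, - (r *\<^sub>R x)) \<in> generator_graph S"
    and "r \<ge> 0" "t \<ge> 0"
  shows "S t x = exp (- r * t) *\<^sub>R x"
proof -
  have lin: "linear (S t)" if "t \<ge> 0" for t
    using S that unfolding C0_semigroup_def bounded_operator_def bounded_linear_def by auto
  have S0: "S 0 x = x" for x
    using S unfolding C0_semigroup_def by auto
  have S_add: "S (s + t) x = S s (S t x)" if "s \<ge> 0" "t \<ge> 0" for s t x
    using S that unfolding C0_semigroup_def by auto
  obtain \<delta> M where \<delta>: "\<delta> > 0" and M: "M \<ge> 0" "\<And>t x. 0 \<le> t \<Longrightarrow> t \<le> \<delta> \<Longrightarrow> norm (S t x) \<le> M * norm x"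
    using C0_semigroup_bounded_near_0[OF S] by metis
  define E where "E h = S h x - exp (- r * h) *\<^sub>R x" for h
  have telescope: "norm (S (real i * h) x - exp (- r * (real i * h)) *\<^sub>R x) \<le> M * real i * norm (E h)"
    if h: "h \<ge> 0" "real i * h \<le> \<delta>" for h i
    using h(2)
  proof (induction i)
    case (Suc i)
    then have i: "real i * h \<le> \<delta>" "real i * h \<ge> 0" using h(1) by (auto simp: algebra_simps)
    have q: "exp (- r * h) \<le> 1" using h(1) \<open>r \<ge> 0\<close> by simp
    have "S (real (Suc i) * h) x = S (real i * h) (S h x)"
      using S_add[OF i(2) h(1)] by (simp add: algebra_simps)
    also have "S h x = E h + exp (- r * h) *\<^sub>R x" unfolding E_def by simp
    finally have "S (real (Suc i) * h) x - exp (- r * (real (Suc i) * h)) *\<^sub>R x =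
        S (real i * h) (E h) + exp (- r * h) *\<^sub>R (S (real i * h) x - exp (- r * (real i * h)) *\<^sub>R x)"
      unfolding linear_add[OF lin[OF i(2)]] linear_scale[OF lin[OF i(2)]]
      by (simp add: algebra_simps exp_add[symmetric])
    also have "norm \<dots> \<le> M * norm (E h) + 1 * (M * real i * norm (E h))"
    proof (rule norm_triangle_mono)
      show "norm (S (real i * h) (E h)) \<le> M * norm (E h)" using M(2) i by auto
      show "norm (exp (- r * h) *\<^sub>R (S (real i * h) x - exp (- r * (real i * h)) *\<^sub>R x)) \<le> 1 * (M * real i * norm (E h))"
        unfolding norm_scaleR using q Suc.IH[OF i(1)] by (intro mult_mono) auto
    qed
    finally show ?case by (simp add: algebra_simps)
  qed (simp add: S0)
  have small: "S t x = exp (- r * t) *\<^sub>R x" if t: "0 < t" "t \<le> \<delta>" for t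
  proof -
    have E_lim: "((\<lambda>h. E h /\<^sub>R h) \<longlongrightarrow> 0) (at_right 0)"
    proof -
      have "((\<lambda>h. (S h x - x) /\<^sub>R h) \<longlongrightarrow> - (r *\<^sub>R x)) (at_right 0)"
        using gen unfolding generator_graph_def by simp
      moreover have "((\<lambda>h. (exp (- r * h) - 1) / h) \<longlongrightarrow> - r) (at_right 0)"
        by real_asymp
      then have "((\<lambda>h. ((exp (- r * h) - 1) / h) *\<^sub>R x) \<longlongrightarrow> (- r) *\<^sub>R x) (at_right 0)"
        by (intro tendsto_intros)
      ultimately have "((\<lambda>h. (S h x - x) /\<^sub>R h - ((exp (- r * h) - 1) / h) *\<^sub>R x) \<longlongrightarrow>
          - (r *\<^sub>R x) - (- r) *\<^sub>R x) (at_right 0)" by (rule tendsto_diff)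
      moreover have "(S h x - x) /\<^sub>R h - ((exp (- r * h) - 1) / h) *\<^sub>R x = E h /\<^sub>R h" for h
        unfolding E_def by (simp add: algebra_simps divide_inverse)
      ultimately show ?thesis by simp
    qed
    have "filterlim (\<lambda>n. t / real (Suc n)) (at_right 0) sequentially"
      using t(1) by real_asymp
    from filterlim_compose[OF E_lim this]
    have lim: "(\<lambda>n. E (t / real (Suc n)) /\<^sub>R (t / real (Suc n))) \<longlonglongrightarrow> 0" .
    have "norm (S t x - exp (- r * t) *\<^sub>R x) \<le> M * t * norm (E (t / real (Suc n)) /\<^sub>R (t / real (Suc n)))" for n
    proof -
      have "real (Suc n) * (t / real (Suc n)) = t" by simp
      moreover have "M * t * norm (E (t / real (Suc n)) /\<^sub>R (t / real (Suc n))) = M * real (Suc n) * norm (E (t / real (Suc n)))"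
        using t(1) by (simp add: field_simps)
      ultimately show ?thesis using telescope[of "t / real (Suc n)" "Suc n"] t by simp
    qed
    moreover have "(\<lambda>n. M * t * norm (E (t / real (Suc n)) /\<^sub>R (t / real (Suc n)))) \<longlonglongrightarrow> M * t * norm (0 :: 'a)"
      by (intro tendsto_intros lim)
    ultimately have "norm (S t x - exp (- r * t) *\<^sub>R x) \<le> M * t * norm (0 :: 'a)"
      by (intro LIMSEQ_le_const[where X = "\<lambda>n. M * t * norm (E (t / real (Suc n)) /\<^sub>R (t / real (Suc n)))"]) auto
    then show ?thesis by simp
  qed
  show ?thesis
  proof (cases "t = 0")
    case False
    with \<open>t \<ge> 0\<close> have "t > 0" by simp
    obtain n where n: "t / \<delta> \<le> real n" using real_arch_simple by blast
    then have n0: "n > 0" using \<open>t > 0\<close> \<delta> by (cases n) (auto simp: divide_le_0_iff)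
    define h where "h = t / real n"
    have h: "h > 0" "h \<le> \<delta>" using \<open>t > 0\<close> n n0 \<delta> by (auto simp: h_def field_simps)
    have "S (real i * h) x = exp (- r * (real i * h)) *\<^sub>R x" for i
    proof (induction i)
      case (Suc i)
      have "S (real (Suc i) * h) x = S (real i * h) (S h x)"
        using S_add[of "real i * h" h x] h by (simp add: algebra_simps)
      also have "\<dots> = exp (- r * h) *\<^sub>R exp (- r * (real i * h)) *\<^sub>R x"
        using h Suc by (simp add: small linear_scale[OF lin])
      finally show ?case by (simp add: exp_add[symmetric] algebra_simps)
    qed (simp add: S0)
    from this[of n] show ?thesis using n0 by (simp add: h_def)
  qed (simp add: S0)
qed

text \<open>Whichever semigroup with generator -A is chosen, its operators agree with the diagonal ones on the
  basis, hence everywhere by continuity.\<close>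

lemma (in hilbert_basis) exp_neg_eq_semigroup:
  assumes nonneg: "\<And>k. \<nu> k \<ge> 0"
    and sa: "self_adjoint ip D A" and eig: "\<And>k. e k \<in> D \<and> A (e k) = \<nu> k *\<^sub>R e k"
    and "t \<ge> 0"
  shows "exp_neg K scl D A t x = semigroup \<nu> t x"
proof -
  define S where "S = exp_neg K scl D A"
  have "C0_semigroup K scl S \<and> generator_graph S = operator_graph D (\<lambda>x. - A x)"
    unfolding S_def exp_neg_def
    by (rule someI[of _ "semigroup \<nu>"])
       (use C0_semigroup_diagonal[of \<nu>, OF nonneg] generator_graph_diagonal[of \<nu>, OF nonneg sa eig] in blast)
  then have S: "C0_semigroup K scl S" and gen: "generator_graph S = operator_graph D (\<lambda>x. - A x)" by auto
  have Se: "S t (e k) = exp (- \<nu> k * t) *\<^sub>R e k" for k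
  proof (rule C0_semigroup_eigenvector[OF S _ nonneg \<open>t \<ge> 0\<close>])
    show "(e k, - (\<nu> k *\<^sub>R e k)) \<in> generator_graph S"
      unfolding gen operator_graph_def using eig[of k] by force
  qed
  have "bounded_linear (S t)" and S_scl: "\<And>c x. c \<in> K \<Longrightarrow> S t (scl c x) = scl c (S t x)"
    using S \<open>t \<ge> 0\<close> unfolding C0_semigroup_def bounded_operator_def by auto
  then have "(\<lambda>k. S t (scl (ip x (e k)) (e k))) sums S t x"
    using bounded_linear.sums expansion by blast
  moreover have "S t (scl (ip x (e k)) (e k)) = scl (of_real (exp (- \<nu> k * t)) * ip x (e k)) (e k)" for k
    by (simp add: S_scl ip_in_K Se scl_scaleR scl_of_real_mult)
  ultimately show ?thesis
    unfolding S_def[symmetric] semigroup_def diag_def by (simp add: sums_iff)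
qed

section \<open>Mild solutions\<close>

lemma norm_set_integral_le_primitive:
  fixes F :: "real \<Rightarrow> 'b::{banach, second_countable_topology}"
  assumes "0 \<le> t" and F: "\<And>s. s \<in> {0<..<t} \<Longrightarrow> norm (F s) \<le> g s"
    and nonneg: "\<And>s. 0 \<le> g s" and cont: "continuous_on UNIV g"
    and prim: "\<And>s. (G has_real_derivative g s) (at s)"
  shows "norm (LBINT s:{0<..<t}. F s) \<le> G t - G 0"
proof -
  let ?g = "\<lambda>s. indicator {0..t} s *\<^sub>R g s"
  have g: "integrable lborel ?g"
    using borel_integrable_atLeastAtMost'[OF continuous_on_subset[OF cont, of "{0..t}"]]
    unfolding set_integrable_def by simp
  have "norm (LBINT s:{0<..<t}. F s) \<le> (LINT s|lborel. norm (indicator {0<..<t} s *\<^sub>R F s))"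
    unfolding set_lebesgue_integral_def by (rule integral_norm_bound)
  also have "\<dots> \<le> (LINT s|lborel. ?g s)"
    by (rule integral_mono'[OF g]) (auto simp: indicator_def F nonneg)
  also have "\<dots> = G t - G 0"
    by (rule integral_FTC_atLeastAtMost[OF \<open>0 \<le> t\<close>])
       (auto intro!: continuous_on_subset[OF cont] has_field_derivative_at_within prim
          simp flip: has_real_derivative_iff_has_vector_derivative)
  finally show ?thesis .
qed

lemma norm_set_integral_le_const:
  fixes F :: "real \<Rightarrow> 'b::{banach, second_countable_topology}"
  assumes "0 \<le> t" "0 \<le> C" "\<And>s. s \<in> {0<..<t} \<Longrightarrow> norm (F s) \<le> C"
  shows "norm (LBINT s:{0<..<t}. F s) \<le> C * t"
  using norm_set_integral_le_primitive[of t F "\<lambda>_. C" "\<lambda>s. C * s"] assms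
  by (auto intro!: derivative_eq_intros)

text \<open>In the norm weighted by exp(-r s) with large r, integration from 0 is a small operator. This
  replaces Gronwall's inequality and makes the Duhamel map a contraction on intervals of any length.\<close>

lemma weighted_norm_set_integral_le:
  fixes F :: "real \<Rightarrow> 'b::{banach, second_countable_topology}"
  assumes "0 \<le> t" "0 \<le> C" "r > 0" "\<And>s. s \<in> {0<..<t} \<Longrightarrow> norm (F s) \<le> C * exp (r * s)"
  shows "exp (- r * t) * norm (LBINT s:{0<..<t}. F s) \<le> C / r"
proof -
  have "norm (LBINT s:{0<..<t}. F s) \<le> C / r * exp (r * t) - C / r * exp (r * 0)"
    by (rule norm_set_integral_le_primitive[where g = "\<lambda>s. C * exp (r * s)"])
       (use assms in \<open>auto intro!: derivative_eq_intros continuous_intros simp: field_simps\<close>)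
  also have "\<dots> \<le> C / r * exp (r * t)" using assms by simp
  finally have "exp (- r * t) * norm (LBINT s:{0<..<t}. F s) \<le> exp (- r * t) * (C / r * exp (r * t))"
    by (rule mult_left_mono) simp
  also have "\<dots> = C / r" by (simp flip: exp_add)
  finally show ?thesis .
qed

lemma mild_equation_cong:
  assumes S: "\<And>t x. 0 \<le> t \<Longrightarrow> S t x = S' t x" and p: "\<And>s. 0 < s \<Longrightarrow> s < T \<Longrightarrow> p s = p' s"
    and u: "\<And>t. 0 \<le> t \<Longrightarrow> t \<le> T \<Longrightarrow> u t = u' t"
    and "mild_equation scl S B p T u0 u"
  shows "mild_equation scl S' B p' T u0 u'"
  unfolding mild_equation_def
proof (intro conjI ballI)
  have eq: "continuous_on {0..T} u" "\<And>t. t \<in> {0..T} \<Longrightarrow>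
       set_integrable lborel {0<..<t} (\<lambda>s. S (t - s) (scl (p s) (B (u s)))) \<and>
       u t = S t u0 - (LBINT s:{0<..<t}. S (t - s) (scl (p s) (B (u s))))"
    using assms(4) unfolding mild_equation_def by auto
  show "continuous_on {0..T} u'" using eq(1) u by (subst continuous_on_cong[of _ "{0..T}" _ u]) auto
  fix t assume t: "t \<in> {0..T}"
  have F: "S (t - s) (scl (p s) (B (u s))) = S' (t - s) (scl (p' s) (B (u' s)))" if "s \<in> {0<..<t}" for s
    using that t by (simp add: S p u)
  show "set_integrable lborel {0<..<t} (\<lambda>s. S' (t - s) (scl (p' s) (B (u' s))))"
    using eq(2)[OF t, THEN conjunct1] by (rule set_integrable_cong[THEN iffD1, rotated -1]) (auto simp: F)
  have "(LBINT s:{0<..<t}. S (t - s) (scl (p s) (B (u s)))) = (LBINT s:{0<..<t}. S' (t - s) (scl (p' s) (B (u' s))))"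
    by (rule set_lebesgue_integral_cong) (auto simp: F)
  then show "u' t = S' t u0 - (LBINT s:{0<..<t}. S' (t - s) (scl (p' s) (B (u' s))))"
    using eq(2)[OF t, THEN conjunct2] t S[of t u0] u[of t] by auto
qed

text \<open>The semigroup with arbitrary nonnegative rates, acted on by a bounded operator B of norm at most b.
  The rates will be both the eigenvalues and their differences with the first one.\<close>

locale bilinear_system = hilbert_basis K scl ip e
  for K :: "complex set"
    and scl :: "complex \<Rightarrow> 'a::{real_inner, banach, second_countable_topology} \<Rightarrow> 'a"
    and ip :: "'a \<Rightarrow> 'a \<Rightarrow> complex"
    and e :: "nat \<Rightarrow> 'a" +
  fixes \<nu> :: "nat \<Rightarrow> real" and B :: "'a \<Rightarrow> 'a" and b :: real
  assumes rate_nonneg: "\<nu> k \<ge> 0"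
    and linear_B: "bounded_linear B"
    and norm_B: "norm (B x) \<le> b * norm x"
    and b_pos: "b > 0"
begin

abbreviation S :: "real \<Rightarrow> 'a \<Rightarrow> 'a"
  where "S \<equiv> semigroup \<nu>"

lemmas coeff_S = coeff_semigroup[of \<nu>, OF rate_nonneg]
  and linear_S = bounded_linear_semigroup[of \<nu>, OF rate_nonneg]
  and norm_S_le = norm_semigroup_le[of \<nu>, OF rate_nonneg]
  and S_add = semigroup_add[of \<nu>, OF rate_nonneg]
  and S_0 = semigroup_0[of \<nu>, OF rate_nonneg]
  and S_scl = semigroup_scl[of \<nu>, OF rate_nonneg]
  and continuous_on_S = continuous_on_semigroup[of \<nu>, OF rate_nonneg]

lemma S_diff: "t \<ge> 0 \<Longrightarrow> S t (x - y) = S t x - S t y"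
  by (rule linear_diff[OF bounded_linear.linear[OF linear_S]])

lemma measurable_S:
  assumes [measurable]: "f \<in> borel_measurable borel"
  shows "(\<lambda>s. S (t - s) (f s)) \<in> borel_measurable borel"
  unfolding semigroup_def diag_def
proof (intro borel_measurable_suminf measurable_scl)
  fix k
  have [measurable]: "(\<lambda>x. ip x (e k)) \<in> borel_measurable borel"
    by (rule borel_measurable_continuous_onI[OF linear_continuous_on[OF bounded_linear_ip_left]])
  show "(\<lambda>s. complex_of_real (exp (- \<nu> k * (t - s))) * ip (f s) (e k)) \<in> borel_measurable borel"
    by measurable
qed (use ip_in_K in auto)

definition duhamel :: "(real \<Rightarrow> 'a) \<Rightarrow> real \<Rightarrow> 'a"
  where "duhamel f t = (LBINT s:{0<..<t}. S (t - s) (f s))"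

lemma set_integrable_duhamel:
  assumes "f \<in> borel_measurable borel" and f: "\<And>s. s \<in> {0<..<t} \<Longrightarrow> norm (f s) \<le> C"
  shows "set_integrable lborel {0<..<t} (\<lambda>s. S (t - s) (f s))"
  unfolding set_integrable_def
proof (rule integrableI_bounded_set_indicator[where B = C])
  show "(\<lambda>s. S (t - s) (f s)) \<in> borel_measurable lborel" using measurable_S[OF assms(1)] by simp
  show "AE s in lborel. s \<in> {0<..<t} \<longrightarrow> norm (S (t - s) (f s)) \<le> C"
    using f by (auto intro!: AE_I2 order_trans[OF norm_S_le])
  show "emeasure lborel {0<..<t} < \<infinity>"
    by (cases "0 \<le> t") (auto simp: less_top[symmetric])
qed auto

text \<open>The integrands converge pointwise off the endpoint of the limit interval, because the semigroup is
  strongly continuous, and are uniformly bounded: dominated convergence.\<close>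

lemma continuous_on_duhamel:
  assumes f: "f \<in> borel_measurable borel" and le: "\<And>s. s \<in> {0<..<T} \<Longrightarrow> norm (f s) \<le> C"
  shows "continuous_on {0..T} (duhamel f)"
proof (rule continuous_on_sequentiallyI)
  fix t :: "nat \<Rightarrow> real" and a
  assume t: "\<forall>n. t n \<in> {0..T}" and a: "a \<in> {0..T}" and lim: "t \<longlonglongrightarrow> a"
  define C' where "C' = max C 0"
  have meas [measurable]: "(\<lambda>s. S (r - s) (f s)) \<in> borel_measurable borel" for r
    by (rule measurable_S[OF f])
  show "(\<lambda>n. duhamel f (t n)) \<longlonglongrightarrow> duhamel f a"
    unfolding duhamel_def set_lebesgue_integral_def
  proof (rule integral_dominated_convergence[where w = "\<lambda>s. indicator {0..T} s *\<^sub>R C'"])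
    show "integrable lborel (\<lambda>s. indicator {0..T} s *\<^sub>R C')"
      using borel_integrable_atLeastAtMost'[of 0 T "\<lambda>_. C'"] unfolding set_integrable_def by simp
    show "(\<lambda>s. indicator {0<..<a} s *\<^sub>R S (a - s) (f s)) \<in> borel_measurable lborel"
      "(\<lambda>s. indicator {0<..<t n} s *\<^sub>R S (t n - s) (f s)) \<in> borel_measurable lborel" for n
      by measurable
    show "AE s in lborel. norm (indicator {0<..<t n} s *\<^sub>R S (t n - s) (f s)) \<le> indicator {0..T} s *\<^sub>R C'" for n
    proof (rule AE_I2)
      fix s
      show "norm (indicator {0<..<t n} s *\<^sub>R S (t n - s) (f s)) \<le> indicator {0..T} s *\<^sub>R C'"
      proof (cases "s \<in> {0<..<t n}")
        case True
        then have "s \<in> {0<..<T}" using t[THEN spec, of n] by auto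
        then show ?thesis using True le[of s] norm_S_le[of "t n - s" "f s"] by (simp add: C'_def)
      qed (auto simp: C'_def indicator_def)
    qed
    show "AE s in lborel. (\<lambda>n. indicator {0<..<t n} s *\<^sub>R S (t n - s) (f s)) \<longlonglongrightarrow> indicator {0<..<a} s *\<^sub>R S (a - s) (f s)"
      using AE_lborel_singleton[of a]
    proof eventually_elim
      case (elim s)
      consider "s \<le> 0" | "0 < s" "s < a" | "a < s" using elim by linarith
      then show ?case
      proof cases
        case 2
        have ev: "\<forall>\<^sub>F n in sequentially. s < t n" using order_tendstoD(1)[OF lim 2(2)] .
        have "(\<lambda>n. S (t n - s) (f s)) \<longlonglongrightarrow> S (a - s) (f s)"
        proof (rule continuous_on_tendsto_compose[OF continuous_on_S])
          show "(\<lambda>n. t n - s) \<longlonglongrightarrow> a - s" by (intro tendsto_intros lim)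
          show "a - s \<in> {0..}" using 2 by auto
          show "\<forall>\<^sub>F n in sequentially. t n - s \<in> {0..}" using ev by eventually_elim auto
        qed
        moreover have "\<forall>\<^sub>F n in sequentially. S (t n - s) (f s) = indicator {0<..<t n} s *\<^sub>R S (t n - s) (f s)"
          using ev by eventually_elim (use 2 in auto)
        ultimately show ?thesis using 2 by (simp add: tendsto_cong)
      next
        case 3
        have "\<forall>\<^sub>F n in sequentially. t n < s" using order_tendstoD(2)[OF lim 3] .
        then have "\<forall>\<^sub>F n in sequentially. indicator {0<..<t n} s *\<^sub>R S (t n - s) (f s) = 0"
          by eventually_elim auto
        then show ?thesis using 3 by (simp add: tendsto_eventually)
      qed auto
    qed
  qed
qed

lemma mild_equation_iff:
  "mild_equation scl S B p T u0 u \<longleftrightarrow> continuous_on {0..T} u \<and>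
    (\<forall>t\<in>{0..T}. set_integrable lborel {0<..<t} (\<lambda>s. S (t - s) (scl (p s) (B (u s)))) \<and>
      u t = S t u0 - duhamel (\<lambda>s. scl (p s) (B (u s))) t)"
  unfolding mild_equation_def duhamel_def ..

lemma norm_forcing_le: "c \<in> K \<Longrightarrow> norm c \<le> P \<Longrightarrow> norm (scl c (B x)) \<le> P * b * norm x"
  unfolding norm_scl mult.assoc by (intro mult_mono norm_B) (auto intro: order_trans[OF norm_ge_zero])

lemma forcing_diff: "c \<in> K \<Longrightarrow> scl c (B (x - y)) = scl c (B x) - scl c (B y)"
  by (simp add: linear_diff[OF bounded_linear.linear] linear_B bounded_linear_scl)

text \<open>At a maximum of the weighted distance between two solutions, the weighted integral estimate shows
  that this maximum is at most half of itself.\<close>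

lemma mild_equation_unique:
  assumes p: "\<And>s. p s \<in> K" "\<And>s. norm (p s) \<le> P"
    and u: "mild_equation scl S B p T u0 u" and v: "mild_equation scl S B p T u0 v" and t: "t \<in> {0..T}"
  shows "u t = v t"
proof -
  have P: "P \<ge> 0" using p(2)[of 0] norm_ge_zero order_trans by blast
  \<comment> \<open>With this weight the integral operator has norm at most P b / r, which is below 1/2.\<close>
  define r where "r = 2 * P * b + 1"
  have r: "r > 0" using P b_pos by (simp add: r_def add_nonneg_pos)
  define D where "D s = exp (- r * s) * norm (u s - v s)" for s
  have "continuous_on {0..T} D"
    unfolding D_def using u v by (auto intro!: continuous_intros simp: mild_equation_iff)
  then obtain t0 where t0: "t0 \<in> {0..T}" "\<And>s. s \<in> {0..T} \<Longrightarrow> D s \<le> D t0"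
    using continuous_attains_sup[of "{0..T}" D] t by auto
  have D0: "0 \<le> D s" for s unfolding D_def by simp
  let ?F = "\<lambda>w s. S (t0 - s) (scl (p s) (B (w s)))"
  have "u t0 - v t0 = - (LBINT s:{0<..<t0}. ?F u s - ?F v s)"
    using u v t0(1) by (simp add: mild_equation_iff duhamel_def set_integral_diff(2))
  then have "D t0 = exp (- r * t0) * norm (LBINT s:{0<..<t0}. ?F u s - ?F v s)"
    unfolding D_def by simp
  also have "\<dots> \<le> P * b * D t0 / r"
  proof (rule weighted_norm_set_integral_le)
    fix s assume s: "s \<in> {0<..<t0}"
    have "?F u s - ?F v s = S (t0 - s) (scl (p s) (B (u s - v s)))"
      using s by (simp add: S_diff forcing_diff p)
    also have "norm \<dots> \<le> P * b * norm (u s - v s)"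
      using s p by (intro order_trans[OF norm_S_le] norm_forcing_le) auto
    also have "norm (u s - v s) = D s * exp (r * s)"
      unfolding D_def by (simp flip: exp_add)
    also have "P * b * (D s * exp (r * s)) \<le> P * b * (D t0 * exp (r * s))"
      using s t0 P b_pos by (intro mult_left_mono mult_right_mono) auto
    finally show "norm (?F u s - ?F v s) \<le> P * b * D t0 * exp (r * s)" by (simp add: mult_ac)
  qed (use t0 r P b_pos D0 in auto)
  also have "\<dots> \<le> D t0 / 2"
  proof -
    have "P * b / r \<le> 1 / 2" using r by (simp add: r_def field_simps)
    from mult_right_mono[OF this D0[of t0]] show ?thesis by simp
  qed
  finally have "D t0 = 0" using D0[of t0] by simp
  then have "D t = 0" using t0(2)[OF t] D0[of t] by simp
  then show ?thesis by (simp add: D_def)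
qed

text \<open>The weighted Duhamel map is a contraction. Freezing time outside of [0,T] lets it act on the complete
  space of bounded continuous functions on the whole line, and passing to exp(-r t) u(t) turns the
  weighted norm into the supremum norm.\<close>

lemma mild_equation_exists:
  assumes T: "T \<ge> 0" and p: "\<And>s. p s \<in> K" "\<And>s. norm (p s) \<le> P" "p \<in> borel_measurable borel"
  shows "\<exists>u. mild_equation scl S B p T u0 u"
proof -
  have P: "P \<ge> 0" using p(2)[of 0] norm_ge_zero order_trans by blast
  \<comment> \<open>The contraction factor of the Duhamel map is P b / r, which is below 1/2.\<close>
  define r where "r = 2 * P * b + 1"
  have r: "r > 0" using P b_pos by (simp add: r_def add_nonneg_pos)
  define clamp where "clamp t = max 0 (min T t)" for t
  have clamp: "clamp t \<in> {0..T}" for t using T by (auto simp: clamp_def)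
  have clamp_id: "t \<in> {0..T} \<Longrightarrow> clamp t = t" for t by (auto simp: clamp_def)
  define f where "f w s = scl (p s) (B (exp (r * s) *\<^sub>R w s))" for w :: "real \<Rightarrow> 'a" and s
  have f_meas: "f w \<in> borel_measurable borel" if "continuous_on UNIV w" for w
  proof -
    have [measurable]: "w \<in> borel_measurable borel" "B \<in> borel_measurable borel"
      using that by (auto intro: borel_measurable_continuous_onI linear_continuous_on linear_B)
    show ?thesis unfolding f_def by (rule measurable_scl) (use p in measurable)
  qed
  have f_le: "norm (f w s) \<le> P * b * (exp (r * s) * norm (w s))" for w s
    unfolding f_def using norm_forcing_le[OF p(1,2), of s "exp (r * s) *\<^sub>R w s"] by simp
  define \<Phi> where "\<Phi> w t = exp (- r * clamp t) *\<^sub>R (S (clamp t) u0 - duhamel (f w) (clamp t))" for w t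
  have f_bound: "\<exists>C. \<forall>s\<in>{0<..<T}. norm (f w s) \<le> C" if "continuous_on UNIV w" for w
  proof -
    have "continuous_on {0..T} (\<lambda>s. P * b * (exp (r * s) * norm (w s)))"
      by (intro continuous_intros continuous_on_subset[OF that]) auto
    then have "bounded ((\<lambda>s. P * b * (exp (r * s) * norm (w s))) ` {0..T})"
      by (intro compact_imp_bounded compact_continuous_image) auto
    then obtain C where "\<And>s. s \<in> {0..T} \<Longrightarrow> norm (P * b * (exp (r * s) * norm (w s))) \<le> C"
      unfolding bounded_iff by blast
    then have "norm (f w s) \<le> C" if "s \<in> {0<..<T}" for s
      using f_le[of w s] that by (smt (verit, best) greaterThanLessThan_iff atLeastAtMost_iff real_norm_def)
    then show ?thesis by blast
  qed
  have \<Phi>_bcontfun: "\<Phi> w \<in> bcontfun" if w: "continuous_on UNIV w" for w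
  proof -
    obtain C where C: "\<And>s. s \<in> {0<..<T} \<Longrightarrow> norm (f w s) \<le> C" using f_bound[OF w] by blast
    let ?\<psi> = "\<lambda>t. exp (- r * t) *\<^sub>R (S t u0 - duhamel (f w) t)"
    have \<psi>: "continuous_on {0..T} ?\<psi>"
      by (intro continuous_intros continuous_on_subset[OF continuous_on_S] continuous_on_duhamel[OF f_meas[OF w] C]) auto
    have "continuous_on UNIV (?\<psi> \<circ> clamp)"
      by (intro continuous_on_compose continuous_on_subset[OF \<psi>])
         (auto simp: clamp_def T intro!: continuous_intros)
    moreover have "bounded (range (?\<psi> \<circ> clamp))"
      by (rule bounded_subset[OF compact_imp_bounded[OF compact_continuous_image[OF \<psi>]]]) (use clamp in auto)
    ultimately show ?thesis unfolding bcontfun_def \<Phi>_def comp_def by auto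
  qed
  have diff: "norm (\<Phi> w t - \<Phi> w' t) \<le> 1 / 2 * d"
    if w: "continuous_on UNIV w" "continuous_on UNIV w'" and d: "\<And>s. norm (w s - w' s) \<le> d" for w w' t d
  proof -
    have d0: "d \<ge> 0" using d[of 0] norm_ge_zero order_trans by blast
    define c where "c = clamp t"
    have c: "c \<in> {0..T}" unfolding c_def by (rule clamp)
    have int: "set_integrable lborel {0<..<c} (\<lambda>s. S (c - s) (f v s))" if v: "continuous_on UNIV v" for v
    proof -
      obtain C where "\<And>s. s \<in> {0<..<T} \<Longrightarrow> norm (f v s) \<le> C" using f_bound[OF v] by blast
      then show ?thesis using c by (intro set_integrable_duhamel[OF f_meas[OF v], where C = C]) auto
    qed
    have "norm (\<Phi> w t - \<Phi> w' t) = exp (- r * c) * norm (LBINT s:{0<..<c}. S (c - s) (f w s) - S (c - s) (f w' s))"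
      unfolding \<Phi>_def c_def[symmetric] duhamel_def set_integral_diff(2)[OF int int, OF w]
      by (simp add: norm_minus_commute flip: scaleR_diff_right)
    also have "\<dots> \<le> P * b * d / r"
    proof (rule weighted_norm_set_integral_le)
      fix s assume s: "s \<in> {0<..<c}"
      have "S (c - s) (f w s) - S (c - s) (f w' s) = S (c - s) (f (\<lambda>s. w s - w' s) s)"
        using s p by (simp add: f_def S_diff forcing_diff scaleR_diff_right)
      also have "norm \<dots> \<le> P * b * (exp (r * s) * norm (w s - w' s))"
        using s by (intro order_trans[OF norm_S_le] f_le) auto
      also have "\<dots> \<le> P * b * (exp (r * s) * d)"
        using P b_pos d by (intro mult_left_mono) auto
      finally show "norm (S (c - s) (f w s) - S (c - s) (f w' s)) \<le> P * b * d * exp (r * s)"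
        by (simp add: mult_ac)
    qed (use c r P b_pos d0 in auto)
    also have "\<dots> \<le> 1 / 2 * d"
    proof -
      have "P * b / r \<le> 1 / 2" using r by (simp add: r_def field_simps)
      from mult_right_mono[OF this d0] show ?thesis by simp
    qed
    finally show ?thesis .
  qed
  define F :: "(real \<Rightarrow>\<^sub>C 'a) \<Rightarrow> (real \<Rightarrow>\<^sub>C 'a)" where "F w = Bcontfun (\<Phi> (apply_bcontfun w))" for w
  have F: "apply_bcontfun (F w) = \<Phi> (apply_bcontfun w)" for w
    unfolding F_def by (rule Bcontfun_inverse) (auto intro: \<Phi>_bcontfun)
  have "\<exists>!w. F w = w"
  proof (rule banach_fix_type[where c = "1 / 2"])
    show "\<forall>w w'. dist (F w) (F w') \<le> 1 / 2 * dist w w'"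
    proof (intro allI dist_bound)
      fix w w' :: "real \<Rightarrow>\<^sub>C 'a" and t
      show "dist (apply_bcontfun (F w) t) (apply_bcontfun (F w') t) \<le> 1 / 2 * dist w w'"
        unfolding F dist_norm using dist_bounded[of w _ w'] by (intro diff) (auto simp: dist_norm)
    qed
  qed auto
  then obtain w where "F w = w" by blast
  then have w: "\<Phi> (apply_bcontfun w) = apply_bcontfun w" using F by metis
  define u where "u s = exp (r * s) *\<^sub>R apply_bcontfun w s" for s
  have w_cont: "continuous_on A (apply_bcontfun w)" for A by simp
  have fw: "f (apply_bcontfun w) = (\<lambda>s. scl (p s) (B (u s)))" unfolding f_def u_def ..
  have "mild_equation scl S B p T u0 u"
    unfolding mild_equation_iff
  proof (intro conjI ballI)
    show "continuous_on {0..T} u" unfolding u_def by (intro continuous_intros w_cont)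
    fix t assume t: "t \<in> {0..T}"
    obtain C where C: "\<And>s. s \<in> {0<..<T} \<Longrightarrow> norm (f (apply_bcontfun w) s) \<le> C"
      using f_bound[OF w_cont] by blast
    show "set_integrable lborel {0<..<t} (\<lambda>s. S (t - s) (scl (p s) (B (u s))))"
      using set_integrable_duhamel[OF f_meas[OF w_cont], of t C] C t unfolding fw by auto
    have "u t = exp (r * t) *\<^sub>R \<Phi> (apply_bcontfun w) t" unfolding u_def w ..
    also have "\<dots> = S t u0 - duhamel (f (apply_bcontfun w)) t"
      unfolding \<Phi>_def clamp_id[OF t] by (simp flip: exp_add)
    finally show "u t = S t u0 - duhamel (\<lambda>s. scl (p s) (B (u s))) t" unfolding fw .
  qed
  then show ?thesis by blast
qed

lemma mild_equation_zero_control: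
  assumes "mild_equation scl S B p T u0 u" "0 \<le> t" "t \<le> T" "\<And>s. 0 < s \<Longrightarrow> s < t \<Longrightarrow> p s = 0"
  shows "u t = S t u0"
proof -
  have "(LBINT s:{0<..<t}. S (t - s) (scl (p s) (B (u s)))) = (LBINT s:{0<..<t}. 0)"
    using assms(4) by (intro set_lebesgue_integral_cong)
      (auto simp: linear_0[OF bounded_linear.linear[OF linear_S]])
  then have "duhamel (\<lambda>s. scl (p s) (B (u s))) t = 0"
    unfolding duhamel_def by (simp add: set_lebesgue_integral_def)
  then show ?thesis using assms unfolding mild_equation_iff by auto
qed

text \<open>Splitting the integral at a, the semigroup law extracts S t from the part before a, which together
  with the initial term becomes S t applied to the state at time a.\<close>

lemma mild_equation_restart:
  assumes u: "mild_equation scl S B p T u0 u" and a: "0 \<le> a" "0 \<le> c" "a + c \<le> T"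
  shows "mild_equation scl S B (\<lambda>s. p (a + s)) c (u a) (\<lambda>s. u (a + s))"
  unfolding mild_equation_def
proof (intro conjI ballI)
  have "continuous_on {0..T} u" using u unfolding mild_equation_def by auto
  then show "continuous_on {0..c} (\<lambda>s. u (a + s))"
    by (rule continuous_on_compose2) (use a in \<open>auto intro!: continuous_intros\<close>)
  fix t assume t: "t \<in> {0..c}"
  define f where "f s = scl (p s) (B (u s))" for s
  have eq: "set_integrable lborel {0<..<r} (\<lambda>s. S (r - s) (f s))"
    "u r = S r u0 - (LBINT s:{0<..<r}. S (r - s) (f s))" if "r \<in> {0..T}" for r
    using u that unfolding mild_equation_def f_def by auto
  let ?G = "\<lambda>s. S (a + t - s) (f s)"
  have G: "set_integrable lborel {0<..<a + t} ?G" using eq(1)[of "a + t"] a t by auto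
  have G1: "set_integrable lborel {0<..<a} ?G" and G2: "set_integrable lborel {a<..<a+t} ?G"
    by (rule set_integrable_subset[OF G]; use a t in auto)+
  have "(LBINT s:{0<..<a + t}. ?G s) = (LBINT s:{0<..<a} \<union> {a<..<a + t}. ?G s)"
  proof (rule set_integral_cong_set)
    show "set_borel_measurable lborel {0<..<a + t} ?G" "set_borel_measurable lborel ({0<..<a} \<union> {a<..<a + t}) ?G"
      using G set_integrable_Un[OF G1 G2]
      unfolding set_borel_measurable_def set_integrable_def by (auto intro: borel_measurable_integrable)
    show "AE s in lborel. (s \<in> {0<..<a} \<union> {a<..<a + t}) = (s \<in> {0<..<a + t})"
      using AE_lborel_singleton[of a] by eventually_elim (use a t in auto)
  qed
  also have "\<dots> = (LBINT s:{0<..<a}. ?G s) + (LBINT s:{a<..<a + t}. ?G s)"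
    by (rule set_integral_Un[OF _ G1 G2]) auto
  also have "(LBINT s:{0<..<a}. ?G s) = S t (LBINT s:{0<..<a}. S (a - s) (f s))"
  proof -
    have "(LBINT s:{0<..<a}. ?G s) = (LBINT s:{0<..<a}. S t (S (a - s) (f s)))"
      using t by (intro set_lebesgue_integral_cong) (auto simp: add.commute[of a] add_diff_eq[symmetric] S_add)
    also have "\<dots> = (LINT s|lborel. S t (indicator {0<..<a} s *\<^sub>R S (a - s) (f s)))"
      unfolding set_lebesgue_integral_def
      using t by (simp add: linear_scale[OF bounded_linear.linear[OF linear_S]])
    also have "\<dots> = S t (LBINT s:{0<..<a}. S (a - s) (f s))"
      unfolding set_lebesgue_integral_def
      using eq(1)[of a] a t by (intro integral_bounded_linear linear_S) (auto simp: set_integrable_def)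
    finally show ?thesis .
  qed
  also have "(LBINT s:{a<..<a + t}. ?G s) = (LBINT s:{0<..<t}. S (t - s) (f (a + s)))"
  proof -
    have "indicator {a<..<a + t} (a + 1 * s) *\<^sub>R ?G (a + 1 * s) = indicator {0<..<t} s *\<^sub>R S (t - s) (f (a + s))" for s
      by (auto simp: indicator_def)
    note shift = this
    show ?thesis unfolding set_lebesgue_integral_def
      by (subst lborel_integral_real_affine[where c = 1 and t = a]) (simp_all only: shift abs_one scaleR_one)
  qed
  finally have "u (a + t) = S t (S a u0) - (S t (LBINT s:{0<..<a}. S (a - s) (f s)) +
      (LBINT s:{0<..<t}. S (t - s) (f (a + s))))"
    using eq(2)[of "a + t"] a t S_add[of t a u0] by (simp add: add.commute)
  also have "\<dots> = S t (u a) - (LBINT s:{0<..<t}. S (t - s) (f (a + s)))"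
    using eq(2)[of a] a t by (simp add: S_diff)
  finally show "u (a + t) = S t (u a) - (LBINT s:{0<..<t}. S (t - s) (scl (p (a + s)) (B (u (a + s)))))"
    unfolding f_def .
  have shift: "indicator {a<..<a + t} (a + 1 * s) *\<^sub>R ?G (a + 1 * s) = indicator {0<..<t} s *\<^sub>R S (t - s) (f (a + s))" for s
    by (auto simp: indicator_def)
  have "integrable lborel (\<lambda>s. indicator {a<..<a + t} (a + 1 * s) *\<^sub>R ?G (a + 1 * s))"
    using lborel_integrable_real_affine[OF G2[unfolded set_integrable_def], of 1 a] by simp
  then show "set_integrable lborel {0<..<t} (\<lambda>s. S (t - s) (scl (p (a + s)) (B (u (a + s)))))"
    unfolding shift unfolding set_integrable_def f_def .
qed

end

section \<open>A finite moment problem\<close>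

lemma norm_coeff_prod_linear_le:
  fixes a b :: "'i \<Rightarrow> real"
  assumes "finite J"
  shows "\<bar>coeff (\<Prod>j\<in>J. [:a j, b j:]) m\<bar> \<le> (\<Prod>j\<in>J. \<bar>a j\<bar> + \<bar>b j\<bar>)"
  using assms
proof (induction J arbitrary: m rule: finite_induct)
  case empty
  then show ?case by (cases m) auto
next
  case (insert i J)
  let ?p = "\<Prod>j\<in>J. [:a j, b j:]" and ?C = "\<Prod>j\<in>J. \<bar>a j\<bar> + \<bar>b j\<bar>"
  have C: "?C \<ge> 0" by (intro prod_nonneg) auto
  have "\<bar>coeff ([:a i, b i:] * ?p) m\<bar> \<le> \<bar>a i\<bar> * \<bar>coeff ?p m\<bar> + \<bar>b i\<bar> * ?C"
  proof (cases m)
    case 0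
    then show ?thesis using C by (simp add: abs_mult)
  next
    case (Suc m')
    have "\<bar>coeff ([:a i, b i:] * ?p) m\<bar> \<le> \<bar>a i * coeff ?p m\<bar> + \<bar>b i * coeff ?p m'\<bar>"
      using Suc by (simp add: abs_triangle_ineq)
    also have "\<dots> \<le> \<bar>a i\<bar> * \<bar>coeff ?p m\<bar> + \<bar>b i\<bar> * ?C"
      unfolding abs_mult by (intro add_left_mono mult_left_mono insert.IH) auto
    finally show ?thesis .
  qed
  also have "\<dots> \<le> \<bar>a i\<bar> * ?C + \<bar>b i\<bar> * ?C"
    by (intro add_right_mono mult_left_mono insert.IH) auto
  finally show ?case using insert by (simp add: distrib_right)
qed

text \<open>The coefficients of the Lagrange interpolation polynomials solve a Vandermonde system, and are
  bounded by products of node ratios. As the polynomials are real, the solution lies in the scalar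
  field of the data.\<close>

lemma (in separable_hilbert_space) vandermonde_solution:
  fixes W :: "nat \<Rightarrow> real" and y :: "nat \<Rightarrow> complex"
  assumes Q: "\<And>j k. j < N \<Longrightarrow> k < N \<Longrightarrow> j \<noteq> k \<Longrightarrow> 1 + \<bar>W j\<bar> \<le> Q * \<bar>W k - W j\<bar>"
    and "Q \<ge> 1" and y: "\<And>k. y k \<in> K"
  obtains c where "\<And>m. c m \<in> K"
    and "\<And>k. k < N \<Longrightarrow> (\<Sum>m<N. c m * of_real (W k ^ m)) = y k"
    and "\<And>m. norm (c m) \<le> (\<Sum>k<N. norm (y k)) * Q ^ N"
proof -
  define L where "L k = (\<Prod>j\<in>{..<N} - {k}. [:- W j / (W k - W j), 1 / (W k - W j):])" for k
  define c where "c m = (\<Sum>k<N. y k * of_real (coeff (L k) m))" for m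
  have distinct: "W k \<noteq> W j" if "j < N" "k < N" "j \<noteq> k" for j k
    using Q[OF that] by auto
  have L_node: "poly (L k) (W i) = (if i = k then 1 else 0)" if "i < N" "k < N" for i k
  proof (cases "i = k")
    case True
    have "poly (L k) (W k) = (\<Prod>j\<in>{..<N} - {k}. 1)"
      unfolding L_def poly_prod
      by (rule prod.cong) (use distinct[OF _ \<open>k < N\<close>] in \<open>auto simp: divide_simps\<close>)
    then show ?thesis using True by simp
  next
    case False
    then have "i \<in> {..<N} - {k}" using that by auto
    moreover have "poly [:- W i / (W k - W i), 1 / (W k - W i):] (W i) = 0" by simp
    ultimately have "poly (L k) (W i) = 0" unfolding L_def poly_prod by (intro prod_zero) auto
    then show ?thesis using False by simp
  qed
  have L_sum: "poly (L k) x = (\<Sum>m<N. coeff (L k) m * x ^ m)" if "k < N" for k x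
  proof -
    have "degree (L k) \<le> sum (degree \<circ> (\<lambda>j. [:- W j / (W k - W j), 1 / (W k - W j):])) ({..<N} - {k})"
      unfolding L_def by (rule degree_prod_sum_le) simp
    also have "\<dots> \<le> (\<Sum>j\<in>{..<N} - {k}. 1)" by (intro sum_mono) auto
    also have "\<dots> = N - 1" using that by simp
    finally have "degree (L k) < N" using that by linarith
    then show ?thesis unfolding poly_altdef
      by (intro sum.mono_neutral_left) (auto simp: coeff_eq_0 not_le)
  qed
  have L_coeff: "\<bar>coeff (L k) m\<bar> \<le> Q ^ N" if "k < N" for k m
  proof -
    have "\<bar>coeff (L k) m\<bar> \<le> (\<Prod>j\<in>{..<N} - {k}. \<bar>- W j / (W k - W j)\<bar> + \<bar>1 / (W k - W j)\<bar>)"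
      unfolding L_def by (rule norm_coeff_prod_linear_le) simp
    also have "\<dots> \<le> (\<Prod>j\<in>{..<N} - {k}. Q)"
    proof (intro prod_mono conjI)
      fix j assume j: "j \<in> {..<N} - {k}"
      then have "\<bar>W k - W j\<bar> > 0" using distinct[of j k] that by auto
      then show "\<bar>- W j / (W k - W j)\<bar> + \<bar>1 / (W k - W j)\<bar> \<le> Q"
        using Q[of j k] j that by (simp add: abs_divide field_simps)
    qed auto
    also have "\<dots> \<le> Q ^ N" using that \<open>Q \<ge> 1\<close> by (simp add: power_increasing)
    finally show ?thesis .
  qed
  show ?thesis
  proof
    show "c m \<in> K" for m unfolding c_def by (intro K_sum K_mult y) auto
    show "(\<Sum>m<N. c m * of_real (W k ^ m)) = y k" if "k < N" for k
    proof -
      have "(\<Sum>m<N. c m * of_real (W k ^ m)) = (\<Sum>m<N. \<Sum>i<N. y i * of_real (coeff (L i) m * W k ^ m))"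
        unfolding c_def sum_distrib_right by (simp add: mult.assoc)
      also have "\<dots> = (\<Sum>i<N. y i * of_real (\<Sum>m<N. coeff (L i) m * W k ^ m))"
        by (subst sum.swap) (simp add: sum_distrib_left)
      also have "\<dots> = (\<Sum>i<N. if i = k then y k else 0)"
        by (rule sum.cong) (use L_node[OF that] in \<open>auto simp: L_sum[symmetric]\<close>)
      also have "\<dots> = y k" using that by simp
      finally show ?thesis .
    qed
    show "norm (c m) \<le> (\<Sum>k<N. norm (y k)) * Q ^ N" for m
    proof -
      have "norm (c m) \<le> (\<Sum>k<N. norm (y k * of_real (coeff (L k) m)))"
        unfolding c_def by (rule norm_sum)
      also have "\<dots> \<le> (\<Sum>k<N. norm (y k) * Q ^ N)"
        by (intro sum_mono) (auto simp: norm_mult intro!: mult_left_mono L_coeff)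
      finally show ?thesis by (simp add: sum_distrib_right)
    qed
  qed
qed

lemma power_le_fact_mult_exp: "0 \<le> (x::real) \<Longrightarrow> x ^ n \<le> fact n * exp x"
proof -
  assume x: "0 \<le> x"
  have "(\<Sum>k\<in>{n}. x ^ k /\<^sub>R fact k) \<le> (\<Sum>k. x ^ k /\<^sub>R fact k)"
    using x by (intro sum_le_suminf summable_exp_generic) auto
  then show ?thesis by (simp add: exp_def divide_inverse[symmetric] field_simps)
qed

text \<open>For x < y the difference exp y - exp x exceeds (y - x) exp x. So nodes with separated exponents are
  separated relative to their size, however large they are, and the interpolation of exponential
  moments costs a factor of order 1/\<delta> per node.\<close>

lemma exponential_nodes_separated:
  fixes \<nu> :: "nat \<Rightarrow> real"
  assumes nonneg: "\<nu> j \<ge> 0" "\<nu> k \<ge> 0" and gap: "\<bar>\<nu> k - \<nu> j\<bar> \<ge> g"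
    and "g > 0" "\<delta> > 0" "\<delta> \<le> 1"
  shows "1 + \<bar>exp (\<nu> j * \<delta>)\<bar> \<le> 2 * (1 + g) / (g * \<delta>) * \<bar>exp (\<nu> k * \<delta>) - exp (\<nu> j * \<delta>)\<bar>"
proof -
  have g\<delta>: "0 < g * \<delta>" "g * \<delta> \<le> g" using assms by auto
  have "exp (\<nu> j * \<delta>) * (g * \<delta>) \<le> (1 + g) * \<bar>exp (\<nu> k * \<delta>) - exp (\<nu> j * \<delta>)\<bar>"
  proof (cases "\<nu> k \<ge> \<nu> j")
    case True
    then have "g * \<delta> \<le> (\<nu> k - \<nu> j) * \<delta>" using gap assms by (intro mult_right_mono) auto
    then have "1 + g * \<delta> \<le> exp ((\<nu> k - \<nu> j) * \<delta>)"
      using exp_ge_add_one_self[of "(\<nu> k - \<nu> j) * \<delta>"] by linarith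
    then have "exp (\<nu> j * \<delta>) * (1 + g * \<delta>) \<le> exp (\<nu> j * \<delta>) * exp ((\<nu> k - \<nu> j) * \<delta>)"
      by (rule mult_left_mono) simp
    also have "\<dots> = exp (\<nu> k * \<delta>)" by (simp flip: exp_add add: algebra_simps)
    finally have "exp (\<nu> j * \<delta>) * (g * \<delta>) \<le> \<bar>exp (\<nu> k * \<delta>) - exp (\<nu> j * \<delta>)\<bar>"
      by (simp add: algebra_simps)
    also have "\<dots> \<le> (1 + g) * \<bar>exp (\<nu> k * \<delta>) - exp (\<nu> j * \<delta>)\<bar>"
      using \<open>g > 0\<close> by (simp add: mult_le_cancel_right1)
    finally show ?thesis .
  next
    case False
    then have "g * \<delta> \<le> (\<nu> j - \<nu> k) * \<delta>" using gap assms by (intro mult_right_mono) auto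
    then have "1 + g * \<delta> \<le> exp ((\<nu> j - \<nu> k) * \<delta>)"
      using exp_ge_add_one_self[of "(\<nu> j - \<nu> k) * \<delta>"] by linarith
    then have "exp (\<nu> k * \<delta>) * (1 + g * \<delta>) \<le> exp (\<nu> k * \<delta>) * exp ((\<nu> j - \<nu> k) * \<delta>)"
      by (rule mult_left_mono) simp
    also have "\<dots> = exp (\<nu> j * \<delta>)" by (simp flip: exp_add add: algebra_simps)
    finally have "exp (\<nu> j * \<delta>) * (g * \<delta>) \<le> (1 + g * \<delta>) * (exp (\<nu> j * \<delta>) - exp (\<nu> k * \<delta>))"
      by (simp add: algebra_simps)
    moreover have "\<nu> k * \<delta> \<le> \<nu> j * \<delta>" using False assms by (intro mult_right_mono) auto
    then have "(1 + g * \<delta>) * (exp (\<nu> j * \<delta>) - exp (\<nu> k * \<delta>)) \<le> (1 + g) * \<bar>exp (\<nu> k * \<delta>) - exp (\<nu> j * \<delta>)\<bar>"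
      using g\<delta> \<open>g > 0\<close> by (intro mult_mono) auto
    ultimately show ?thesis by (rule order_trans)
  qed
  moreover have "1 \<le> exp (\<nu> j * \<delta>)" using nonneg assms by simp
  then have "(1 + \<bar>exp (\<nu> j * \<delta>)\<bar>) * (g * \<delta>) \<le> (2 * exp (\<nu> j * \<delta>)) * (g * \<delta>)"
    using g\<delta> by (intro mult_right_mono) auto
  ultimately have "(1 + \<bar>exp (\<nu> j * \<delta>)\<bar>) * (g * \<delta>) \<le> 2 * (1 + g) * \<bar>exp (\<nu> k * \<delta>) - exp (\<nu> j * \<delta>)\<bar>"
    by linarith
  then show ?thesis using g\<delta> by (simp add: pos_le_divide_eq)
qed

text \<open>A linear combination of indicators of consecutive intervals of length \<delta>, the first of which starts at
  time \<delta>. This delay multiplies the moment of order r by exp(r \<delta>). At common endpoints two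
  coefficients add up, which is harmless for integrals and accounted for in the bound by N times C.\<close>

definition step_control :: "nat \<Rightarrow> real \<Rightarrow> (nat \<Rightarrow> complex) \<Rightarrow> real \<Rightarrow> complex"
  where "step_control N \<delta> c s = (\<Sum>m<N. c m * of_real (indicator {real (m + 1) * \<delta> .. real (m + 2) * \<delta>} s))"

text \<open>The integral of exp(r s) over [0,\<delta>].\<close>

definition step_integral :: "real \<Rightarrow> real \<Rightarrow> real"
  where "step_integral \<delta> r = (if r = 0 then \<delta> else (exp (r * \<delta>) - 1) / r)"

lemma step_integral_ge: "\<delta> \<ge> 0 \<Longrightarrow> r \<ge> 0 \<Longrightarrow> \<delta> \<le> step_integral \<delta> r"
  using exp_ge_add_one_self[of "r * \<delta>"] by (auto simp: step_integral_def field_simps)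

lemma measurable_step_control: "step_control N \<delta> c \<in> borel_measurable borel"
  unfolding step_control_def by measurable

lemma norm_step_control_le:
  assumes "\<And>m. norm (c m) \<le> C" shows "norm (step_control N \<delta> c s) \<le> real N * C"
proof -
  have "norm (step_control N \<delta> c s) \<le> (\<Sum>m<N. norm (c m * of_real (indicator {real (m + 1) * \<delta> .. real (m + 2) * \<delta>} s)))"
    unfolding step_control_def by (rule norm_sum)
  also have "\<dots> \<le> (\<Sum>m<N. C)"
  proof (rule sum_mono)
    fix m
    have "0 \<le> C" using assms[of m] norm_ge_zero order_trans by blast
    then show "norm (c m * of_real (indicator {real (m + 1) * \<delta> .. real (m + 2) * \<delta>} s)) \<le> C"
      using assms[of m] by (auto simp: norm_mult indicator_def)
  qed
  finally show ?thesis by simp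
qed

text \<open>Shifting an interval by \<delta> multiplies the integral of exp(r s) over it by exp(r \<delta>). The moments of a
  step control are therefore values of the polynomial with the same coefficients, and prescribing
  finitely many of them is a Vandermonde system.\<close>

lemma moment_step_control:
  assumes \<delta>: "\<delta> > 0" and t: "real (N + 1) * \<delta> < t"
  shows "(LBINT s:{0<..<t}. of_real (exp (r * s)) * step_control N \<delta> c s) =
    of_real (step_integral \<delta> r * exp (r * \<delta>)) * (\<Sum>m<N. c m * of_real (exp (r * \<delta>) ^ m))"
proof -
  define a where "a m = real (m + 1) * \<delta>" for m
  define G where "G s = (if r = 0 then s else exp (r * s) / r)" for s
  let ?h = "\<lambda>m s. indicator {a m .. a (m + 1)} s *\<^sub>R exp (r * s)"
  have int: "integrable lborel (?h m)" for m
  proof -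
    have "continuous_on {a m .. a (m + 1)} (\<lambda>s. exp (r * s))" by (intro continuous_intros)
    from borel_integrable_atLeastAtMost'[OF this] show ?thesis unfolding set_integrable_def .
  qed
  have piece: "(LINT s|lborel. ?h m s) = step_integral \<delta> r * exp (r * \<delta>) * exp (r * \<delta>) ^ m" for m
  proof -
    have "(LINT s|lborel. ?h m s) = G (a (m + 1)) - G (a m)"
    proof (rule integral_FTC_atLeastAtMost)
      show "a m \<le> a (m + 1)" using \<delta> by (simp add: a_def)
      show "(G has_vector_derivative exp (r * s)) (at s within {a m..a (m + 1)})" for s
        unfolding G_def has_real_derivative_iff_has_vector_derivative[symmetric]
        by (cases "r = 0") (auto intro!: derivative_eq_intros)
    qed (intro continuous_intros)
    also have "\<dots> = step_integral \<delta> r * exp (r * \<delta>) * exp (r * \<delta>) ^ m"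
    proof (cases "r = 0")
      case False
      have "exp (r * a m) = exp (r * \<delta>) * exp (r * \<delta>) ^ m" for m
        by (simp add: a_def exp_of_nat_mult[symmetric] algebra_simps flip: exp_add)
      then show ?thesis using False by (simp add: G_def step_integral_def field_simps)
    qed (simp add: G_def step_integral_def a_def algebra_simps)
    finally show ?thesis .
  qed
  have "(LBINT s:{0<..<t}. of_real (exp (r * s)) * step_control N \<delta> c s) =
      (LINT s|lborel. (\<Sum>m<N. c m * of_real (?h m s)))"
    unfolding set_lebesgue_integral_def
  proof (rule Bochner_Integration.integral_cong[OF refl])
    fix s
    show "indicator {0<..<t} s *\<^sub>R (complex_of_real (exp (r * s)) * step_control N \<delta> c s) =
        (\<Sum>m<N. c m * of_real (?h m s))"
    proof (cases "s \<in> {0<..<t}")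
      case True
      then show ?thesis
        by (auto simp: step_control_def sum_distrib_left a_def indicator_def add.commute intro!: sum.cong)
    next
      case False
      have "s \<notin> {a m .. a (m + 1)}" if "m < N" for m
      proof -
        have "a (m + 1) \<le> real (N + 1) * \<delta>" unfolding a_def using \<delta> that by (intro mult_right_mono) auto
        moreover have "0 < a m" using \<delta> by (simp add: a_def)
        ultimately show ?thesis using False t by auto
      qed
      then have "(\<Sum>m<N. c m * of_real (?h m s)) = 0" by (intro sum.neutral) auto
      then show ?thesis using False by simp
    qed
  qed
  also have "\<dots> = (\<Sum>m<N. LINT s|lborel. c m * of_real (?h m s))"
    by (rule Bochner_Integration.integral_sum) (intro integrable_mult_right integrable_of_real int)
  also have "\<dots> = (\<Sum>m<N. c m * of_real (LINT s|lborel. ?h m s))"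
    by (simp only: integral_mult_right_zero integral_complex_of_real)
  also have "\<dots> = of_real (step_integral \<delta> r * exp (r * \<delta>)) * (\<Sum>m<N. c m * of_real (exp (r * \<delta>) ^ m))"
    unfolding piece by (simp add: sum_distrib_left mult_ac)
  finally show ?thesis .
qed

section \<open>One control step\<close>

context bilinear_system
begin

lemma S_ground: "\<nu> 0 = 0 \<Longrightarrow> t \<ge> 0 \<Longrightarrow> S t (e 0) = e 0"
  by (rule coeff_eqI) (auto simp: coeff_S orthonormal)

lemma coeff_duhamel:
  assumes p: "\<And>s. p s \<in> K" "\<And>s. norm (p s) \<le> P" "p \<in> borel_measurable borel"
  shows "ip (duhamel (\<lambda>s. scl (p s) x) t) (e k) =
    of_real (exp (- \<nu> k * t)) * ip x (e k) * (LBINT s:{0<..<t}. of_real (exp (\<nu> k * s)) * p s)"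
proof -
  have "set_integrable lborel {0<..<t} (\<lambda>s. S (t - s) (scl (p s) x))"
    by (rule set_integrable_duhamel[where C = "P * norm x"])
       (auto intro!: measurable_scl p mult_right_mono simp: norm_scl p)
  then have "ip (duhamel (\<lambda>s. scl (p s) x) t) (e k) =
      (LINT s|lborel. ip (indicator {0<..<t} s *\<^sub>R S (t - s) (scl (p s) x)) (e k))"
    unfolding duhamel_def set_lebesgue_integral_def set_integrable_def
    by (rule integral_bounded_linear[OF bounded_linear_ip_left, symmetric])
  also have "\<dots> = (LINT s|lborel. (of_real (exp (- \<nu> k * t)) * ip x (e k)) *
      (indicator {0<..<t} s *\<^sub>R (of_real (exp (\<nu> k * s)) * p s)))"
  proof (rule Bochner_Integration.integral_cong[OF refl])
    fix s
    have "exp (- \<nu> k * (t - s)) = exp (- \<nu> k * t) * exp (\<nu> k * s)"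
      by (simp flip: exp_add add: algebra_simps)
    then show "ip (indicator {0<..<t} s *\<^sub>R S (t - s) (scl (p s) x)) (e k) =
        (of_real (exp (- \<nu> k * t)) * ip x (e k)) * (indicator {0<..<t} s *\<^sub>R (of_real (exp (\<nu> k * s)) * p s))"
      by (cases "s \<in> {0<..<t}") (simp_all add: coeff_S ip_scl_left p mult_ac)
  qed
  also have "\<dots> = of_real (exp (- \<nu> k * t)) * ip x (e k) * (LBINT s:{0<..<t}. of_real (exp (\<nu> k * s)) * p s)"
    unfolding set_lebesgue_integral_def by (rule integral_mult_right_zero)
  finally show ?thesis .
qed

end

text \<open>Growth of the rates makes the high modes dissipate fast, the gap separates the nodes of the moment
  problem, and the lower bound on the coefficients of B e_0 makes every mode accessible to the
  linearized control. That e_0 is stationary is expressed by the vanishing of its rate.\<close>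

locale controllable_system = bilinear_system K scl ip e \<nu> B b
  for K :: "complex set"
    and scl :: "complex \<Rightarrow> 'a::{real_inner, banach, second_countable_topology} \<Rightarrow> 'a"
    and ip :: "'a \<Rightarrow> 'a \<Rightarrow> complex"
    and e :: "nat \<Rightarrow> 'a"
    and \<nu> :: "nat \<Rightarrow> real" and B :: "'a \<Rightarrow> 'a" and b :: real +
  fixes a g \<beta> :: real and n :: nat
  assumes ground_rate: "\<nu> 0 = 0"
    and growth: "a * (real k)\<^sup>2 \<le> \<nu> k"
    and gap: "j \<noteq> k \<Longrightarrow> g \<le> \<bar>\<nu> k - \<nu> j\<bar>"
    and spread: "\<beta> \<le> norm (ip (B (e 0)) (e k)) * (1 + \<nu> k) ^ n"
    and a_pos: "a > 0" and g_pos: "g > 0" and \<beta>_pos: "\<beta> > 0"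
begin

definition control_cost :: "nat \<Rightarrow> real \<Rightarrow> real"
  where "control_cost N \<delta> =
    (real N)\<^sup>2 * (fact n * exp 1 / (\<beta> * \<delta> ^ (n + 1))) * (2 * (1 + g) / (g * \<delta>)) ^ N"

lemma control_cost_nonneg: "\<delta> > 0 \<Longrightarrow> control_cost N \<delta> \<ge> 0"
  unfolding control_cost_def using g_pos \<beta>_pos by simp

text \<open>The first N modes of the linearized equation with initial state v vanish after the control has ended
  exactly if I k, the moment of the control of order \<nu> k, is the quotient of the coefficients of v and
  of B e_0. This quotient may grow like the n-th power of the rate; the factor exp(\<nu> k \<delta>) gained by
  starting the control at time \<delta> dominates such growth, so the cost depends on N and \<delta> only.\<close>

lemma low_modes_controllable:
  assumes \<delta>: "0 < \<delta>" "\<delta> \<le> 1"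
  obtains p I where "\<And>s. p s \<in> K" "p \<in> borel_measurable borel"
    "\<And>s. norm (p s) \<le> control_cost N \<delta> * norm v"
    "\<And>t k. real (N + 1) * \<delta> < t \<Longrightarrow> (LBINT s:{0<..<t}. of_real (exp (\<nu> k * s)) * p s) = I k"
    "\<And>k. k < N \<Longrightarrow> ip (B (e 0)) (e k) * I k = ip v (e k)"
proof -
  define A where "A = fact n * exp 1 / (\<beta> * \<delta> ^ (n + 1))"
  define Q where "Q = 2 * (1 + g) / (g * \<delta>)"
  define W where "W k = exp (\<nu> k * \<delta>)" for k
  define E where "E k = step_integral \<delta> (\<nu> k)" for k
  define y where "y k = ip v (e k) / (ip (B (e 0)) (e k) * of_real (E k * W k))" for k
  have B0: "ip (B (e 0)) (e k) \<noteq> 0" for k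
    using spread[of k] \<beta>_pos by auto
  have E: "\<delta> \<le> E k" "0 < E k" for k
    using step_integral_ge[of \<delta> "\<nu> k"] \<delta> rate_nonneg[of k] by (auto simp: E_def)
  have W: "0 < W k" for k by (simp add: W_def)
  have A: "0 < A" unfolding A_def using \<beta>_pos \<delta> by simp
  have y_le: "norm (y k) \<le> norm v * A" for k
  proof -
    let ?\<beta>k = "norm (ip (B (e 0)) (e k))"
    have "\<beta> * \<delta> ^ n \<le> ?\<beta>k * (1 + \<nu> k) ^ n * \<delta> ^ n"
      using spread[of k] \<delta> by (intro mult_right_mono) auto
    also have "\<dots> = ?\<beta>k * ((1 + \<nu> k) * \<delta>) ^ n" by (simp add: power_mult_distrib)
    also have "\<dots> \<le> ?\<beta>k * (fact n * exp ((1 + \<nu> k) * \<delta>))"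
      using \<delta> rate_nonneg[of k] by (intro mult_left_mono power_le_fact_mult_exp) auto
    also have "\<dots> \<le> ?\<beta>k * (fact n * (exp 1 * W k))"
      unfolding W_def exp_add[symmetric] using \<delta> by (intro mult_left_mono) (auto simp: algebra_simps)
    finally have "\<beta> * \<delta> ^ n * \<delta> \<le> ?\<beta>k * (fact n * (exp 1 * W k)) * E k"
      by (rule mult_mono) (use E[of k] \<delta> W[of k] in auto)
    then have "1 \<le> A * (?\<beta>k * (E k * W k))"
      unfolding A_def using \<beta>_pos \<delta> by (simp add: field_simps)
    then have "norm (ip v (e k)) * 1 \<le> norm v * (A * (?\<beta>k * (E k * W k)))"
      using norm_ip_le[of v "e k"] by (intro mult_mono) auto
    then show ?thesis
      using E[of k] W[of k] B0[of k] by (simp add: y_def norm_divide norm_mult divide_simps mult_ac)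
  qed
  have "Q \<ge> 1"
  proof -
    have "g * \<delta> \<le> g" using \<delta> g_pos by (intro mult_left_le) auto
    also have "g \<le> 2 * (1 + g)" using g_pos by simp
    finally have "g * \<delta> \<le> 2 * (1 + g)" .
    then show ?thesis unfolding Q_def using \<delta> g_pos by simp
  qed
  obtain c where c: "\<And>m. c m \<in> K" "\<And>k. k < N \<Longrightarrow> (\<Sum>m<N. c m * of_real (W k ^ m)) = y k"
    "\<And>m. norm (c m) \<le> (\<Sum>k<N. norm (y k)) * Q ^ N"
  proof (rule vandermonde_solution[of N W Q y])
    show "1 + \<bar>W j\<bar> \<le> Q * \<bar>W k - W j\<bar>" if "j < N" "k < N" "j \<noteq> k" for j k
      unfolding W_def Q_def using that gap rate_nonneg \<delta> g_pos by (intro exponential_nodes_separated) auto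
    show "y k \<in> K" for k
      unfolding y_def by (intro K_divide K_mult ip_in_K K_real)
  qed (use \<open>Q \<ge> 1\<close> in auto)
  show ?thesis
  proof (rule that[of "step_control N \<delta> c" "\<lambda>k. of_real (E k * W k) * (\<Sum>m<N. c m * of_real (W k ^ m))"])
    show "step_control N \<delta> c s \<in> K" for s
      unfolding step_control_def by (intro K_sum K_mult c(1) K_real)
    show "step_control N \<delta> c \<in> borel_measurable borel" by (rule measurable_step_control)
    show "(LBINT s:{0<..<t}. of_real (exp (\<nu> k * s)) * step_control N \<delta> c s) =
        of_real (E k * W k) * (\<Sum>m<N. c m * of_real (W k ^ m))" if "real (N + 1) * \<delta> < t" for t k
      unfolding E_def W_def by (rule moment_step_control[OF \<delta>(1) that])
    show "ip (B (e 0)) (e k) * (of_real (E k * W k) * (\<Sum>m<N. c m * of_real (W k ^ m))) = ip v (e k)"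
      if "k < N" for k
      using B0[of k] E[of k] W[of k] unfolding c(2)[OF that] by (simp add: y_def)
    show "norm (step_control N \<delta> c s) \<le> control_cost N \<delta> * norm v" for s
    proof -
      have "norm (c m) \<le> (real N * (norm v * A)) * Q ^ N" for m
      proof -
        have "(\<Sum>k<N. norm (y k)) \<le> (\<Sum>k<N. norm v * A)" by (intro sum_mono y_le)
        then have "(\<Sum>k<N. norm (y k)) * Q ^ N \<le> (real N * (norm v * A)) * Q ^ N"
          using \<open>Q \<ge> 1\<close> by (intro mult_right_mono) auto
        then show ?thesis using c(3)[of m] by linarith
      qed
      then have "norm (step_control N \<delta> c s) \<le> real N * ((real N * (norm v * A)) * Q ^ N)"
        by (rule norm_step_control_le)
      also have "\<dots> = control_cost N \<delta> * norm v"
        by (simp add: control_cost_def A_def Q_def power2_eq_square mult_ac)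
      finally show ?thesis .
    qed
  qed
qed

text \<open>The deviation from e_0 at time \<tau> is the sum of two parts. The part driven by B e_0 has no component on
  the first N modes; its other modes decay at rate at least M during the second half of the interval,
  when the control is off. The part driven by B (u - e_0) is quadratic in the initial deviation,
  since control and deviation are both of first order.\<close>

lemma control_step:
  assumes tail: "\<And>k. k \<ge> N \<Longrightarrow> M \<le> \<nu> k"
    and \<delta>: "0 < \<delta>" "\<delta> \<le> 1" and \<tau>: "\<tau> = 2 * real (N + 2) * \<delta>"
    and \<kappa>: "\<kappa> = control_cost N \<delta> * b * \<tau>"
    and w: "norm (w - e 0) \<le> \<epsilon>" and small: "\<kappa> * \<epsilon> \<le> 1 / 2"
  obtains p where "\<And>s. p s \<in> K" "p \<in> borel_measurable borel"
    "\<And>s. norm (p s) \<le> control_cost N \<delta> * \<epsilon>"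
    "\<And>u. mild_equation scl S B p \<tau> w u \<Longrightarrow>
      norm (u \<tau> - e 0) \<le> exp (- M * (\<tau> / 2)) * ((1 + \<kappa>) * \<epsilon>) + 2 * \<kappa> * (1 + \<kappa>) * \<epsilon>\<^sup>2"
proof -
  define v where "v = w - e 0"
  define P where "P = control_cost N \<delta> * \<epsilon>"
  define h where "h = \<tau> / 2"
  have \<epsilon>: "\<epsilon> \<ge> 0" using w norm_ge_zero order_trans by blast
  have cost: "control_cost N \<delta> \<ge> 0" using \<delta>(1) by (rule control_cost_nonneg)
  have \<tau>0: "\<tau> > 0" unfolding \<tau> using \<delta> by simp
  have h: "h = real (N + 2) * \<delta>" "h > 0" using \<tau> \<tau>0 by (auto simp: h_def)
  \<comment> \<open>The control ends at time (N + 1) \<delta>, before half of the interval has passed.\<close>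
  have late: "real (N + 1) * \<delta> < h" "real (N + 1) * \<delta> < \<tau>"
    using \<delta> h(1) \<tau>0 by (auto simp: h_def algebra_simps)
  have P: "P \<ge> 0" using cost \<epsilon> by (simp add: P_def)
  have Pb: "P * b * \<tau> = \<kappa> * \<epsilon>" by (simp add: P_def \<kappa>)
  have \<kappa>0: "\<kappa> \<ge> 0" unfolding \<kappa> using cost b_pos \<tau>0 by simp
  obtain p I where p: "\<And>s. p s \<in> K" "p \<in> borel_measurable borel"
    "\<And>s. norm (p s) \<le> control_cost N \<delta> * norm v"
    and I: "\<And>t k. real (N + 1) * \<delta> < t \<Longrightarrow> (LBINT s:{0<..<t}. of_real (exp (\<nu> k * s)) * p s) = I k"
    and null: "\<And>k. k < N \<Longrightarrow> ip (B (e 0)) (e k) * I k = ip v (e k)"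
    by (rule low_modes_controllable[OF \<delta>, of N v], rule that; simp)
  have pP: "norm (p s) \<le> P" for s
    unfolding P_def using p(3)[of s] mult_left_mono[OF w cost] unfolding v_def by linarith
  have forcing_le: "norm (S r (scl (p s) (B x))) \<le> P * b * norm x" if "r \<ge> 0" for r s x
    using norm_S_le[OF that] norm_forcing_le[OF p(1) pP] order_trans by blast
  have e0: "P * b * norm (e 0) = P * b" by simp
  show ?thesis
  proof (rule that[OF p(1,2)])
    show "norm (p s) \<le> control_cost N \<delta> * \<epsilon>" for s using pP unfolding P_def .
    fix u assume u: "mild_equation scl S B p \<tau> w u"
    have u_eq: "u t - e 0 = S t v - duhamel (\<lambda>s. scl (p s) (B (u s))) t" if "t \<in> {0..\<tau>}" for t
      using u that unfolding mild_equation_iff v_def by (auto simp: S_diff S_ground[OF ground_rate])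
    have "continuous_on {0..\<tau>} (\<lambda>t. norm (u t - e 0))"
      using u unfolding mild_equation_iff by (intro continuous_intros) auto
    then obtain t0 where t0: "t0 \<in> {0..\<tau>}" "\<And>t. t \<in> {0..\<tau>} \<Longrightarrow> norm (u t - e 0) \<le> norm (u t0 - e 0)"
      using continuous_attains_sup[of "{0..\<tau>}" "\<lambda>t. norm (u t - e 0)"] \<tau>0 by auto
    define m where "m = norm (u t0 - e 0)"
    have m: "norm (u t - e 0) \<le> m" if "t \<in> {0..\<tau>}" for t using t0(2)[OF that] by (simp add: m_def)
    have m0: "m \<ge> 0" by (simp add: m_def)
    \<comment> \<open>An a priori bound on the whole interval: the forcing is at most half of the maximal deviation
      plus a term of first order, and the former is absorbed.\<close>
    have m_le: "m \<le> 2 * (1 + \<kappa>) * \<epsilon>"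
    proof -
      have "norm (LBINT s:{0<..<t0}. S (t0 - s) (scl (p s) (B (u s)))) \<le> P * b * (1 + m) * t0"
      proof (rule norm_set_integral_le_const)
        fix s assume s: "s \<in> {0<..<t0}"
        have "norm (S (t0 - s) (scl (p s) (B (u s)))) \<le> P * b * norm (u s)"
          using s by (intro forcing_le) auto
        also have "\<dots> \<le> P * b * (1 + m)"
        proof -
          have "norm (u s) \<le> norm (e 0) + norm (u s - e 0)" by (metis add.commute diff_add_cancel norm_triangle_ineq)
          then show ?thesis using m[of s] s t0(1) P b_pos by (intro mult_left_mono) auto
        qed
        finally show "norm (S (t0 - s) (scl (p s) (B (u s)))) \<le> P * b * (1 + m)" .
      qed (use t0 P b_pos m0 in auto)
      also have "\<dots> \<le> P * b * (1 + m) * \<tau>"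
        using t0 P b_pos m0 by (intro mult_left_mono) auto
      also have "\<dots> = \<kappa> * \<epsilon> * (1 + m)" using Pb by (metis mult.assoc mult.commute)
      finally have D: "norm (duhamel (\<lambda>s. scl (p s) (B (u s))) t0) \<le> \<kappa> * \<epsilon> + (\<kappa> * \<epsilon>) * m"
        unfolding duhamel_def by (simp add: algebra_simps)
      have "m \<le> norm (S t0 v) + norm (duhamel (\<lambda>s. scl (p s) (B (u s))) t0)"
        unfolding m_def u_eq[OF t0(1)] by (rule norm_triangle_ineq4)
      also have "\<dots> \<le> \<epsilon> + (\<kappa> * \<epsilon> + (\<kappa> * \<epsilon>) * m)"
        using D norm_S_le[of t0 v] t0(1) w unfolding v_def by auto
      finally have "m \<le> \<epsilon> + \<kappa> * \<epsilon> + (\<kappa> * \<epsilon>) * m" by simp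
      moreover have "(\<kappa> * \<epsilon>) * m \<le> 1 / 2 * m" using small m0 by (intro mult_right_mono) auto
      ultimately show ?thesis by (simp add: algebra_simps)
    qed
    define lin where "lin t = S t v - duhamel (\<lambda>s. scl (p s) (B (e 0))) t" for t
    have forcing_meas: "(\<lambda>s. scl (p s) (B (e 0))) \<in> borel_measurable borel"
      by (intro measurable_scl p) auto
    have int: "set_integrable lborel {0<..<t} (\<lambda>s. S (t - s) (scl (p s) (B (e 0))))" for t
      by (rule set_integrable_duhamel[OF forcing_meas, where C = "P * b"])
         (use norm_forcing_le[OF p(1) pP, of _ "e 0"] in simp)
    have lin_coeff: "ip (lin t) (e k) = of_real (exp (- \<nu> k * t)) * (ip v (e k) - ip (B (e 0)) (e k) * I k)"
      if "real (N + 1) * \<delta> < t" for t k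
    proof -
      have "0 \<le> real (N + 1) * \<delta>" using \<delta> by simp
      then have "t \<ge> 0" using that by linarith
      moreover have "ip (duhamel (\<lambda>s. scl (p s) (B (e 0))) t) (e k) = of_real (exp (- \<nu> k * t)) * ip (B (e 0)) (e k) * I k"
        unfolding coeff_duhamel[OF p(1) pP p(2)] I[OF that] ..
      ultimately show ?thesis
        unfolding lin_def by (simp add: ip_diff_left coeff_S algebra_simps)
    qed
    have "norm (lin \<tau>) \<le> exp (- M * h) * norm (lin h)"
    proof (rule norm_le_coeffs)
      fix k
      show "norm (ip (lin \<tau>) (e k)) \<le> exp (- M * h) * norm (ip (lin h) (e k))"
      proof (cases "k < N")
        case True
        then show ?thesis using lin_coeff[OF late(2), of k] null[of k] by simp
      next
        case False
        have "exp (- \<nu> k * \<tau>) = exp (- \<nu> k * h) * exp (- \<nu> k * h)"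
          by (simp add: h_def flip: exp_add)
        also have "\<dots> \<le> exp (- M * h) * exp (- \<nu> k * h)"
          using tail[of k] False h(2) by (intro mult_right_mono) auto
        finally show ?thesis
          unfolding lin_coeff[OF late(1)] lin_coeff[OF late(2)] norm_mult norm_of_real
          by (simp add: mult_right_mono flip: mult.assoc)
      qed
    qed simp
    also have "\<dots> \<le> exp (- M * h) * ((1 + \<kappa>) * \<epsilon>)"
    proof (rule mult_left_mono)
      have "norm (duhamel (\<lambda>s. scl (p s) (B (e 0))) h) \<le> P * b * h"
        unfolding duhamel_def
        by (rule norm_set_integral_le_const) (use h P b_pos forcing_le[of _ _ "e 0"] in auto)
      also have "\<dots> \<le> P * b * \<tau>" using P b_pos \<tau>0 by (intro mult_left_mono) (auto simp: h_def)
      finally have "norm (duhamel (\<lambda>s. scl (p s) (B (e 0))) h) \<le> \<kappa> * \<epsilon>" using Pb by simp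
      moreover have "norm (S h v) \<le> \<epsilon>" using norm_S_le[of h v] h w by (simp add: v_def)
      ultimately show "norm (lin h) \<le> (1 + \<kappa>) * \<epsilon>"
        unfolding lin_def using norm_triangle_ineq4[of "S h v" "duhamel (\<lambda>s. scl (p s) (B (e 0))) h"]
        by (simp add: algebra_simps)
    qed simp
    finally have lin_le: "norm (lin \<tau>) \<le> exp (- M * h) * ((1 + \<kappa>) * \<epsilon>)" .
    define z where "z = (LBINT s:{0<..<\<tau>}. S (\<tau> - s) (scl (p s) (B (u s))) - S (\<tau> - s) (scl (p s) (B (e 0))))"
    have "z = duhamel (\<lambda>s. scl (p s) (B (u s))) \<tau> - duhamel (\<lambda>s. scl (p s) (B (e 0))) \<tau>"
      unfolding z_def duhamel_def using u \<tau>0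
      by (intro set_integral_diff(2) int) (auto simp: mild_equation_iff)
    then have "u \<tau> - e 0 = lin \<tau> - z"
      using u_eq[of \<tau>] \<tau>0 by (simp add: lin_def)
    then have "norm (u \<tau> - e 0) \<le> norm (lin \<tau>) + norm z" by (simp add: norm_triangle_ineq4)
    also have "norm z \<le> P * b * m * \<tau>"
      unfolding z_def
    proof (rule norm_set_integral_le_const)
      fix s assume s: "s \<in> {0<..<\<tau>}"
      have "S (\<tau> - s) (scl (p s) (B (u s))) - S (\<tau> - s) (scl (p s) (B (e 0))) = S (\<tau> - s) (scl (p s) (B (u s - e 0)))"
        using s by (simp add: S_diff forcing_diff p)
      also have "norm \<dots> \<le> P * b * norm (u s - e 0)" using s by (intro forcing_le) auto
      also have "\<dots> \<le> P * b * m" using m[of s] s P b_pos by (intro mult_left_mono) auto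
      finally show "norm (S (\<tau> - s) (scl (p s) (B (u s))) - S (\<tau> - s) (scl (p s) (B (e 0)))) \<le> P * b * m" .
    qed (use \<tau>0 P b_pos m0 in auto)
    also have "P * b * m * \<tau> = (\<kappa> * \<epsilon>) * m" using Pb by (metis mult.assoc mult.commute)
    also have "\<dots> \<le> (\<kappa> * \<epsilon>) * (2 * (1 + \<kappa>) * \<epsilon>)"
      using m_le \<kappa>0 \<epsilon> by (intro mult_left_mono) auto
    also have "\<dots> = 2 * \<kappa> * (1 + \<kappa>) * \<epsilon>\<^sup>2" by (simp add: power2_eq_square mult_ac)
    finally show "norm (u \<tau> - e 0) \<le> exp (- M * (\<tau> / 2)) * ((1 + \<kappa>) * \<epsilon>) + 2 * \<kappa> * (1 + \<kappa>) * \<epsilon>\<^sup>2"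
      using lin_le unfolding h_def by simp
  qed
qed

end

section \<open>Exact controllability\<close>

text \<open>The lengths of the stages x, x + 1, x + 2, ... telescope to the finite total 1/x.\<close>

definition stage_length :: "real \<Rightarrow> real"
  where "stage_length x = 1 / (x * (x + 1))"

text \<open>The distance from the target at the beginning of stage x.\<close>

definition stage_radius :: "real \<Rightarrow> real"
  where "stage_radius x = exp (- (x ^ 6))"

definition (in separable_hilbert_space) bounded_control :: "real \<Rightarrow> (real \<Rightarrow> complex) \<Rightarrow> bool"
  where "bounded_control P p \<longleftrightarrow> (\<forall>s. p s \<in> K) \<and> p \<in> borel_measurable borel \<and> (\<forall>s. norm (p s) \<le> P)"

text \<open>In stage x the first x^4 modes are controlled, with \<delta> the inverse of 2 x (x + 1) (x^4 + 2). The
  logarithm of the cost is then of order x^4 ln x.\<close>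

lemma control_cost_asymptotics:
  fixes C c d :: real
  assumes "C > 0"
  shows "\<forall>\<^sub>F x::real in at_top. 8 * ln x + c + d * ln (2 * x * (x + 1) * (x ^ 4 + 2)) +
      x ^ 4 * ln (C * (2 * x * (x + 1) * (x ^ 4 + 2))) \<le> x ^ 5"
  using assms by real_asymp

text \<open>From stage x to stage x + 1 the radius shrinks by a factor whose logarithm is of order -x^5. Both
  parts of the deviation allow for this: the exponent of the decay of the high modes is of order -x^6,
  as their rates are at least a x^8 and the stage has a length of order x^(-2), and the quadratic part
  carries an additional factor of size exp(-x^6). The cost exp(x^5) is of lower order.\<close>

lemma deviation_asymptotics:
  fixes a b :: real
  assumes "a > 0" "b > 0"
  shows "\<forall>\<^sub>F x::real in at_top. exp (x ^ 5) * exp (- (x ^ 6)) \<le> 1"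
    and "\<forall>\<^sub>F x::real in at_top. b * exp (x ^ 5) * exp (- (x ^ 6)) \<le> 1 / 2"
    and "\<forall>\<^sub>F x::real in at_top.
      exp (- (a * x ^ 8) * (1 / (x * (x + 1)) / 2)) * ((1 + b * exp (x ^ 5)) * exp (- (x ^ 6))) \<le> exp (- ((x + 1) ^ 6)) / 2"
    and "\<forall>\<^sub>F x::real in at_top.
      2 * (b * exp (x ^ 5)) * (1 + b * exp (x ^ 5)) * (exp (- (x ^ 6)))\<^sup>2 \<le> exp (- ((x + 1) ^ 6)) / 2"
  using assms by real_asymp+

lemma (in hilbert_basis) semigroup_shift_rates:
  assumes "\<And>k. \<mu> k \<ge> 0" "r \<ge> 0" "t \<ge> 0"
  shows "semigroup (\<lambda>k. \<mu> k + r) t x = exp (- r * t) *\<^sub>R semigroup \<mu> t x"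
proof (rule coeff_eqI)
  fix k
  have "exp (- (\<mu> k + r) * t) = exp (- r * t) * exp (- \<mu> k * t)"
    by (simp flip: exp_add add: algebra_simps)
  then show "ip (semigroup (\<lambda>k. \<mu> k + r) t x) (e k) = ip (exp (- r * t) *\<^sub>R semigroup \<mu> t x) (e k)"
    using assms by (simp add: coeff_semigroup ip_scaleR_left)
qed

text \<open>For a fixed control the equation is linear in the state, so multiplication by exp(-r t) amounts to
  adding r to all rates.\<close>

lemma (in hilbert_basis) mild_equation_shift_rates:
  assumes \<mu>: "\<And>k. \<mu> k \<ge> 0" and "r \<ge> 0" and B: "bounded_linear B" and p: "\<And>s. p s \<in> K"
    and w: "mild_equation scl (semigroup \<mu>) B p T u0 w"
  shows "mild_equation scl (semigroup (\<lambda>k. \<mu> k + r)) B p T u0 (\<lambda>t. exp (- r * t) *\<^sub>R w t)"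
  unfolding mild_equation_def
proof (intro conjI ballI)
  have eq: "continuous_on {0..T} w" "\<And>t. t \<in> {0..T} \<Longrightarrow>
      set_integrable lborel {0<..<t} (\<lambda>s. semigroup \<mu> (t - s) (scl (p s) (B (w s)))) \<and>
      w t = semigroup \<mu> t u0 - (LBINT s:{0<..<t}. semigroup \<mu> (t - s) (scl (p s) (B (w s))))"
    using w unfolding mild_equation_def by auto
  show "continuous_on {0..T} (\<lambda>t. exp (- r * t) *\<^sub>R w t)" by (intro continuous_intros eq(1))
  fix t assume t: "t \<in> {0..T}"
  have F: "semigroup (\<lambda>k. \<mu> k + r) (t - s) (scl (p s) (B (exp (- r * s) *\<^sub>R w s))) =
      exp (- r * t) *\<^sub>R semigroup \<mu> (t - s) (scl (p s) (B (w s)))" if "s \<in> {0<..<t}" for s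
  proof -
    have ts: "t - s \<ge> 0" using that by simp
    have "exp (- r * (t - s)) * exp (- r * s) = exp (- r * t)" by (simp flip: exp_add add: algebra_simps)
    then show ?thesis
      by (simp add: semigroup_shift_rates[OF \<mu> \<open>r \<ge> 0\<close> ts] scl_scaleR[OF p]
            linear_scale[OF bounded_linear.linear[OF B]]
            linear_scale[OF bounded_linear.linear[OF bounded_linear_semigroup[OF \<mu> ts]]])
  qed
  have "set_integrable lborel {0<..<t} (\<lambda>s. exp (- r * t) *\<^sub>R semigroup \<mu> (t - s) (scl (p s) (B (w s))))"
    using eq(2)[OF t] by simp
  then show "set_integrable lborel {0<..<t} (\<lambda>s. semigroup (\<lambda>k. \<mu> k + r) (t - s) (scl (p s) (B (exp (- r * s) *\<^sub>R w s))))"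
    by (rule set_integrable_cong[THEN iffD1, rotated -1]) (simp_all only: F)
  have "(LBINT s:{0<..<t}. semigroup (\<lambda>k. \<mu> k + r) (t - s) (scl (p s) (B (exp (- r * s) *\<^sub>R w s)))) =
      (LBINT s:{0<..<t}. exp (- r * t) *\<^sub>R semigroup \<mu> (t - s) (scl (p s) (B (w s))))"
    by (rule set_lebesgue_integral_cong) (auto simp only: F sets_lborel borel_open open_greaterThanLessThan)
  also have "\<dots> = exp (- r * t) *\<^sub>R (LBINT s:{0<..<t}. semigroup \<mu> (t - s) (scl (p s) (B (w s))))"
    by simp
  finally have I: "(LBINT s:{0<..<t}. semigroup (\<lambda>k. \<mu> k + r) (t - s) (scl (p s) (B (exp (- r * s) *\<^sub>R w s)))) =
      exp (- r * t) *\<^sub>R (LBINT s:{0<..<t}. semigroup \<mu> (t - s) (scl (p s) (B (w s))))" .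
  have "semigroup (\<lambda>k. \<mu> k + r) t u0 = exp (- r * t) *\<^sub>R semigroup \<mu> t u0"
    using t by (intro semigroup_shift_rates \<mu> \<open>r \<ge> 0\<close>) simp
  then show "exp (- r * t) *\<^sub>R w t = semigroup (\<lambda>k. \<mu> k + r) t u0 -
      (LBINT s:{0<..<t}. semigroup (\<lambda>k. \<mu> k + r) (t - s) (scl (p s) (B (exp (- r * s) *\<^sub>R w s))))"
    unfolding I using eq(2)[OF t] by (metis scaleR_diff_right)
qed

context controllable_system
begin

lemma control_cost_le:
  assumes "x > 0" and x: "x = real j"
    and le: "8 * ln x + ln (fact n * exp 1 / \<beta>) + real (n + 1) * ln (2 * x * (x + 1) * (x ^ 4 + 2)) +
      x ^ 4 * ln (2 * (1 + g) / g * (2 * x * (x + 1) * (x ^ 4 + 2))) \<le> x ^ 5"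
  shows "control_cost (j ^ 4) (1 / (2 * x * (x + 1) * (x ^ 4 + 2))) \<le> exp (x ^ 5)"
proof -
  define D where "D = 2 * x * (x + 1) * (x ^ 4 + 2)"
  have D: "D > 0" unfolding D_def using \<open>x > 0\<close> by (intro mult_pos_pos add_pos_pos) auto
  have pow: "y ^ m = exp (real m * ln y)" if "y > 0" for y :: real and m
    using that by (simp add: exp_of_nat_mult)
  have "control_cost (j ^ 4) (1 / D) =
      x ^ 8 * (fact n * exp 1 / \<beta>) * D ^ (n + 1) * (2 * (1 + g) / g * D) ^ (j ^ 4)"
    unfolding control_cost_def using D assms g_pos \<beta>_pos
    by (simp add: power_divide field_simps flip: power_mult)
  also have "\<dots> = exp (8 * ln x) * exp (ln (fact n * exp 1 / \<beta>)) * exp (real (n + 1) * ln D) *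
      exp (x ^ 4 * ln (2 * (1 + g) / g * D))"
    using D assms g_pos \<beta>_pos pow[of x 8] pow[of D "n + 1"] pow[of "2 * (1 + g) / g * D" "j ^ 4"] by simp
  also have "\<dots> = exp (8 * ln x + ln (fact n * exp 1 / \<beta>) + real (n + 1) * ln D + x ^ 4 * ln (2 * (1 + g) / g * D))"
    by (simp only: exp_add)
  also have "\<dots> \<le> exp (x ^ 5)" using le unfolding D_def by simp
  finally show ?thesis unfolding D_def .
qed

text \<open>One control step, applied with N = j^4 and with \<delta> chosen such that 2 (N + 2) \<delta> is the length of the
  stage, meets the radius prescribed for the next stage.\<close>

lemma control_schedule:
  "\<exists>j0::nat\<ge>1. \<forall>j\<ge>j0. \<forall>w. norm (w - e 0) \<le> stage_radius (real j) \<longrightarrow>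
    (\<exists>p. bounded_control 1 p \<and> (\<forall>u. mild_equation scl S B p (stage_length (real j)) w u \<longrightarrow>
      norm (u (stage_length (real j)) - e 0) \<le> stage_radius (real j + 1)))"
proof -
  let ?D = "\<lambda>x::real. 2 * x * (x + 1) * (x ^ 4 + 2)"
  have pos: "2 * (1 + g) / g > 0" using g_pos by simp
  have "\<forall>\<^sub>F x::real in at_top. x \<ge> 1 \<and>
      8 * ln x + ln (fact n * exp 1 / \<beta>) + real (n + 1) * ln (?D x) + x ^ 4 * ln (2 * (1 + g) / g * ?D x) \<le> x ^ 5 \<and>
      exp (x ^ 5) * exp (- (x ^ 6)) \<le> 1 \<and>
      b * exp (x ^ 5) * exp (- (x ^ 6)) \<le> 1 / 2 \<and>
      exp (- (a * x ^ 8) * (1 / (x * (x + 1)) / 2)) * ((1 + b * exp (x ^ 5)) * exp (- (x ^ 6))) \<le> exp (- ((x + 1) ^ 6)) / 2 \<and>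
      2 * (b * exp (x ^ 5)) * (1 + b * exp (x ^ 5)) * (exp (- (x ^ 6)))\<^sup>2 \<le> exp (- ((x + 1) ^ 6)) / 2"
    by (intro eventually_conj control_cost_asymptotics[OF pos] deviation_asymptotics[OF a_pos b_pos] eventually_ge_at_top)
  then obtain x0 where x0: "\<And>x. x \<ge> x0 \<Longrightarrow> x \<ge> 1 \<and>
      8 * ln x + ln (fact n * exp 1 / \<beta>) + real (n + 1) * ln (?D x) + x ^ 4 * ln (2 * (1 + g) / g * ?D x) \<le> x ^ 5 \<and>
      exp (x ^ 5) * exp (- (x ^ 6)) \<le> 1 \<and>
      b * exp (x ^ 5) * exp (- (x ^ 6)) \<le> 1 / 2 \<and>
      exp (- (a * x ^ 8) * (1 / (x * (x + 1)) / 2)) * ((1 + b * exp (x ^ 5)) * exp (- (x ^ 6))) \<le> exp (- ((x + 1) ^ 6)) / 2 \<and>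
      2 * (b * exp (x ^ 5)) * (1 + b * exp (x ^ 5)) * (exp (- (x ^ 6)))\<^sup>2 \<le> exp (- ((x + 1) ^ 6)) / 2"
    unfolding eventually_at_top_linorder by blast
  obtain j0 :: nat where j0: "x0 \<le> real j0" using real_arch_simple by blast
  show ?thesis
  proof (intro exI[of _ j0] conjI allI impI)
    show "j0 \<ge> 1" using x0[OF j0] by simp
    fix j w assume "j0 \<le> j" and w: "norm (w - e 0) \<le> stage_radius (real j)"
    define x where "x = real j"
    define \<tau> where "\<tau> = stage_length x"
    define \<delta> where "\<delta> = 1 / ?D x"
    define \<kappa> where "\<kappa> = control_cost (j ^ 4) \<delta> * b * \<tau>"
    define \<epsilon> where "\<epsilon> = stage_radius x"
    have "x0 \<le> x" using j0 \<open>j0 \<le> j\<close> unfolding x_def by linarith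
    note asym = x0[OF this]
    have x1: "x \<ge> 1" and x0: "x > 0" using asym by auto
    have D1: "?D x \<ge> 1"
    proof -
      have "1 * 1 * 1 \<le> (2 * x) * (x + 1) * (x ^ 4 + 2)"
        using x1 by (intro mult_mono) auto
      then show ?thesis by simp
    qed
    have \<delta>: "0 < \<delta>" "\<delta> \<le> 1" unfolding \<delta>_def using D1 by auto
    have \<tau>: "\<tau> = 2 * real (j ^ 4 + 2) * \<delta>"
    proof -
      have "x ^ 4 + 2 > 0" using x0 by (simp add: add_pos_pos)
      moreover have "1 / (x * (x + 1)) = 2 * X * (1 / (2 * x * (x + 1) * X))" if "X > 0" for X
        using that x0 by (simp add: divide_simps)
      ultimately have "1 / (x * (x + 1)) = 2 * (x ^ 4 + 2) * (1 / ?D x)" by blast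
      moreover have "real (j ^ 4 + 2) = x ^ 4 + 2" by (simp add: x_def)
      ultimately show ?thesis unfolding \<tau>_def \<delta>_def stage_length_def by simp
    qed
    have \<tau>1: "0 < \<tau>" "\<tau> \<le> 1"
    proof -
      have "1 * 1 \<le> x * (x + 1)" using x1 by (intro mult_mono) auto
      then show "0 < \<tau>" "\<tau> \<le> 1" unfolding \<tau>_def stage_length_def using x0 by auto
    qed
    have cost: "control_cost (j ^ 4) \<delta> \<le> exp (x ^ 5)"
      unfolding \<delta>_def using asym x0 by (intro control_cost_le) (auto simp: x_def)
    have cost0: "control_cost (j ^ 4) \<delta> \<ge> 0" using \<delta>(1) by (rule control_cost_nonneg)
    have \<kappa>: "0 \<le> \<kappa>" "\<kappa> \<le> b * exp (x ^ 5)"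
    proof -
      show "0 \<le> \<kappa>" unfolding \<kappa>_def using cost0 b_pos \<tau>1 by simp
      have "\<kappa> \<le> (exp (x ^ 5) * b) * 1"
        unfolding \<kappa>_def using cost cost0 b_pos \<tau>1 by (intro mult_mono) auto
      then show "\<kappa> \<le> b * exp (x ^ 5)" by (simp add: mult.commute)
    qed
    have \<epsilon>: "\<epsilon> > 0" by (simp add: \<epsilon>_def stage_radius_def)
    have small: "\<kappa> * \<epsilon> \<le> 1 / 2"
      using mult_right_mono[OF \<kappa>(2), of \<epsilon>] \<epsilon> asym unfolding \<epsilon>_def stage_radius_def by linarith
    have tail: "a * x ^ 8 \<le> \<nu> k" if "k \<ge> j ^ 4" for k
    proof -
      have "real (j ^ 4) \<le> real k" using that by (simp only: of_nat_le_iff)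
      then have "(x ^ 4)\<^sup>2 \<le> (real k)\<^sup>2" unfolding x_def by (intro power_mono) auto
      then have "a * x ^ 8 \<le> a * (real k)\<^sup>2" using a_pos by (simp flip: power_mult)
      then show ?thesis using growth[of k] by linarith
    qed
    obtain p where p: "\<And>s. p s \<in> K" "p \<in> borel_measurable borel"
      "\<And>s. norm (p s) \<le> control_cost (j ^ 4) \<delta> * \<epsilon>"
      "\<And>u. mild_equation scl S B p \<tau> w u \<Longrightarrow>
        norm (u \<tau> - e 0) \<le> exp (- (a * x ^ 8) * (\<tau> / 2)) * ((1 + \<kappa>) * \<epsilon>) + 2 * \<kappa> * (1 + \<kappa>) * \<epsilon>\<^sup>2"
    proof (rule control_step)
      show "a * x ^ 8 \<le> \<nu> k" if "j ^ 4 \<le> k" for k using that by (rule tail)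
      show "norm (w - e 0) \<le> \<epsilon>" using w unfolding \<epsilon>_def x_def .
    qed (use \<delta> \<tau> \<kappa>_def small in auto)
    have "norm (p s) \<le> 1" for s
    proof -
      have "control_cost (j ^ 4) \<delta> * \<epsilon> \<le> exp (x ^ 5) * \<epsilon>" using cost \<epsilon> by simp
      then show ?thesis using p(3)[of s] asym unfolding \<epsilon>_def stage_radius_def by linarith
    qed
    moreover have "norm (u \<tau> - e 0) \<le> stage_radius (x + 1)" if "mild_equation scl S B p \<tau> w u" for u
    proof -
      have "exp (- (a * x ^ 8) * (\<tau> / 2)) * ((1 + \<kappa>) * \<epsilon>) \<le>
          exp (- (a * x ^ 8) * (\<tau> / 2)) * ((1 + b * exp (x ^ 5)) * \<epsilon>)"
        using \<kappa> \<epsilon> by (intro mult_left_mono mult_right_mono) auto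
      moreover have "2 * \<kappa> * (1 + \<kappa>) * \<epsilon>\<^sup>2 \<le> 2 * (b * exp (x ^ 5)) * (1 + b * exp (x ^ 5)) * \<epsilon>\<^sup>2"
        using \<kappa> by (intro mult_right_mono mult_mono) auto
      ultimately show ?thesis
        using p(4)[OF that] asym unfolding \<epsilon>_def \<tau>_def stage_radius_def stage_length_def by linarith
    qed
    ultimately show "\<exists>p. bounded_control 1 p \<and> (\<forall>u. mild_equation scl S B p (stage_length (real j)) w u \<longrightarrow>
        norm (u (stage_length (real j)) - e 0) \<le> stage_radius (real j + 1))"
      using p(1,2) unfolding bounded_control_def x_def \<tau>_def by blast
  qed
qed

text \<open>Controls on consecutive intervals that accumulate at T are joined to a single bounded control. Its
  solution is defined on the closed interval from the outset, passes through the prescribed states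
  by uniqueness, and by continuity ends in their limit.\<close>

lemma steer_by_concatenation:
  assumes t: "strict_mono t" "t 0 \<ge> 0" "t \<longlonglongrightarrow> T"
    and bounded: "\<And>j. bounded_control P (q j)"
    and v: "\<And>j. mild_equation scl S B (q j) (t (Suc j) - t j) (w j) (v j)"
      "\<And>j. v j (t (Suc j) - t j) = w (Suc j)"
    and w: "w 0 = S (t 0) u0" "w \<longlonglongrightarrow> x"
  shows "\<exists>p u. bounded_control P p \<and> mild_equation scl S B p T u0 u \<and> u T = x"
proof -
  have q: "\<And>j s. q j s \<in> K" "\<And>j. q j \<in> borel_measurable borel" "\<And>j s. norm (q j s) \<le> P"
    using bounded unfolding bounded_control_def by auto
  have t_less: "t j < t (Suc j)" for j using t(1) by (simp add: strict_mono_Suc_iff)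
  have t_le_T: "t j \<le> T" for j
    using t(1,3) by (intro incseq_le strict_mono_mono) auto
  have t_nonneg: "0 \<le> t j" for j
    using t(2) strict_mono_mono[OF t(1)] by (meson le0 monoD order_trans)
  have P: "P \<ge> 0" using q(3)[of 0 0] norm_ge_zero order_trans by blast
  \<comment> \<open>The number of the interval containing s, for s between t 0 and T. Before t 0 the state evolves freely.\<close>
  define J where "J s = (LEAST j. s < t (Suc j))" for s
  define p where "p s = (if t 0 < s \<and> s < T then q (J s) (s - t (J s)) else 0)" for s
  have p_piece: "p (t j + s) = q j s" if s: "0 < s" "s < t (Suc j) - t j" for j s
  proof -
    have "J (t j + s) = j" unfolding J_def
    proof (rule Least_equality)
      show "t j + s < t (Suc j)" using s by simp
      fix i assume "t j + s < t (Suc i)"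
      then have "t j < t (Suc i)" using s by simp
      then show "j \<le> i" using strict_mono_less[OF t(1)] by auto
    qed
    moreover have "t 0 \<le> t j" using strict_mono_mono[OF t(1)] by (simp add: monoD)
    moreover have "t j + s < T" using s t_le_T[of "Suc j"] by simp
    ultimately show ?thesis using s unfolding p_def by simp
  qed
  have pK: "p s \<in> K" and pP: "norm (p s) \<le> P" for s
    using q P unfolding p_def by auto
  have p_meas: "p \<in> borel_measurable borel"
  proof -
    note q(2)[measurable]
    have [measurable]: "J \<in> measurable borel (count_space UNIV)" unfolding J_def by measurable
    have "(\<lambda>s. q (J s) (s - t (J s))) \<in> borel_measurable borel"
      by (rule measurable_compose_countable[where f = "\<lambda>j s. q j (s - t j)" and g = J]) measurable
    then show ?thesis unfolding p_def by measurable
  qed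
  have T: "0 \<le> T" using t_nonneg[of 0] t_le_T[of 0] by linarith
  obtain u where u: "mild_equation scl S B p T u0 u"
    using mild_equation_exists[OF T pK pP p_meas] by blast
  have u_t: "u (t j) = w j" for j
  proof (induction j)
    case 0
    show ?case unfolding w(1)
      by (rule mild_equation_zero_control[OF u t(2) t_le_T]) (simp add: p_def)
  next
    case (Suc j)
    let ?\<tau> = "t (Suc j) - t j"
    have \<tau>: "0 \<le> ?\<tau>" "t j + ?\<tau> \<le> T" using t_less[of j] t_le_T[of "Suc j"] by auto
    have "mild_equation scl S B (\<lambda>s. p (t j + s)) ?\<tau> (w j) (\<lambda>s. u (t j + s))"
      using mild_equation_restart[OF u t_nonneg \<tau>] unfolding Suc.IH .
    then have "mild_equation scl S B (q j) ?\<tau> (w j) (\<lambda>s. u (t j + s))"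
      by (rule mild_equation_cong[rotated -1]) (simp_all add: p_piece)
    from mild_equation_unique[OF q(1,3) this v(1), of ?\<tau>] \<tau>(1) show ?case by (simp add: v(2))
  qed
  have "(\<lambda>j. u (t j)) \<longlonglongrightarrow> u T"
  proof (rule continuous_on_tendsto_compose[OF _ t(3)])
    show "continuous_on {0..T} u" using u unfolding mild_equation_def by blast
    show "\<forall>\<^sub>F j in sequentially. t j \<in> {0..T}"
      by (intro always_eventually allI) (simp add: t_nonneg t_le_T)
  qed (use T in simp)
  moreover have "(\<lambda>j. u (t j)) \<longlonglongrightarrow> x" unfolding u_t by (rule w(2))
  ultimately have "u T = x" by (rule LIMSEQ_unique)
  then show ?thesis using pK p_meas pP u unfolding bounded_control_def by blast
qed

text \<open>The component along e_0 is stationary, and all others decay at rate at least a.\<close>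

lemma free_evolution_near_ground_state:
  assumes "t \<ge> 0"
  shows "norm (S t x - e 0) \<le> norm (ip x (e 0) - 1) + exp (- a * t) * norm (x - scl (ip x (e 0)) (e 0))"
proof -
  have spectral_gap: "a \<le> \<nu> k" if "k > 0" for k
  proof -
    have "a * 1 \<le> a * (real k)\<^sup>2" using a_pos that by (intro mult_left_mono) auto
    then show ?thesis using growth[of k] by linarith
  qed
  define y where "y = x - scl (ip x (e 0)) (e 0)"
  have "S t x - e 0 = scl (ip x (e 0) - 1) (e 0) + S t y"
    unfolding y_def using \<open>t \<ge> 0\<close>
    by (simp add: S_diff S_scl ip_in_K S_ground[OF ground_rate] scl_diff_left)
  moreover have "norm (scl (ip x (e 0) - 1) (e 0)) = norm (ip x (e 0) - 1)"
    by (subst norm_scl) (use ip_in_K in auto)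
  moreover have "norm (S t y) \<le> exp (- a * t) * norm y"
  proof (rule norm_le_coeffs)
    fix k
    show "norm (ip (S t y) (e k)) \<le> exp (- a * t) * norm (ip y (e k))"
    proof (cases "k = 0")
      case True
      have "ip y (e 0) = 0" by (simp add: y_def ip_diff_left ip_scl_left ip_in_K orthonormal)
      then show ?thesis using True \<open>t \<ge> 0\<close> by (simp add: coeff_S)
    next
      case False
      then have "a * t \<le> \<nu> k * t" using spectral_gap[of k] \<open>t \<ge> 0\<close> by (intro mult_right_mono) auto
      then show ?thesis using \<open>t \<ge> 0\<close> by (simp add: coeff_S norm_mult mult_right_mono)
    qed
  qed simp
  ultimately show ?thesis
    using norm_triangle_ineq[of "scl (ip x (e 0) - 1) (e 0)" "S t y"] unfolding y_def[symmetric] by simp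
qed

text \<open>The radius r is fixed by the first stage from which on the schedule works. The size R of the
  components off e_0 only determines the time tR of free evolution that precedes the stages.\<close>

lemma controllable_to_ground_state:
  shows "\<exists>r>0. \<forall>R>0. \<exists>T>0. \<forall>u0.
    norm (ip u0 (e 0) - 1) < r \<and> norm (u0 - scl (ip u0 (e 0)) (e 0)) \<le> R \<longrightarrow>
    (\<exists>p u. bounded_control 1 p \<and> mild_equation scl S B p T u0 u \<and> u T = e 0)"
proof -
  obtain j0 :: nat where "j0 \<ge> 1"
    and step: "\<forall>j\<ge>j0. \<forall>w. norm (w - e 0) \<le> stage_radius (real j) \<longrightarrow>
      (\<exists>q. bounded_control 1 q \<and> (\<forall>u. mild_equation scl S B q (stage_length (real j)) w u \<longrightarrow>
        norm (u (stage_length (real j)) - e 0) \<le> stage_radius (real j + 1)))"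
    using control_schedule by blast
  define r where "r = stage_radius (real j0) / 2"
  have r: "r > 0" by (simp add: r_def stage_radius_def)
  have \<tau>_pos: "stage_length (real (j0 + j)) > 0" for j
    using \<open>j0 \<ge> 1\<close> unfolding stage_length_def by simp
  have "\<exists>T>0. \<forall>u0. norm (ip u0 (e 0) - 1) < r \<and> norm (u0 - scl (ip u0 (e 0)) (e 0)) \<le> R \<longrightarrow>
    (\<exists>p u. bounded_control 1 p \<and> mild_equation scl S B p T u0 u \<and> u T = e 0)" if "R > 0" for R
  proof -
    \<comment> \<open>The time after which components of size R have decayed below r; it is 0 if they are small already.\<close>
    define tR where "tR = max 0 (ln (R / r) / a)"
    have tR: "tR \<ge> 0" "exp (- a * tR) * R \<le> r"
    proof -
      show "tR \<ge> 0" by (simp add: tR_def)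
      have "ln (R / r) \<le> a * tR" unfolding tR_def using a_pos by (auto simp: max_def field_simps)
      then have "R / r \<le> exp (a * tR)" using \<open>R > 0\<close> r by (metis divide_pos_pos exp_le_cancel_iff exp_ln)
      then show "exp (- a * tR) * R \<le> r" using r by (simp add: exp_minus field_simps)
    qed
    define T where "T = tR + 1 / real j0"
    define t where "t j = T - 1 / real (j0 + j)" for j
    have t_step: "t (Suc j) - t j = stage_length (real (j0 + j))" for j
    proof -
      define x where "x = real (j0 + j)"
      have x: "x > 0" "real (j0 + Suc j) = x + 1" using \<open>j0 \<ge> 1\<close> by (simp_all add: x_def)
      have "1 / x - 1 / (x + 1) = stage_length x"
        unfolding stage_length_def using x(1) by (simp add: divide_simps)
      then show ?thesis unfolding t_def x(2) x_def[symmetric] by simp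
    qed
    have t: "strict_mono t" "t 0 = tR" "t \<longlonglongrightarrow> T"
    proof -
      show "strict_mono t" unfolding strict_mono_Suc_iff
      proof
        fix j show "t j < t (Suc j)" using t_step[of j] \<tau>_pos[of j] by linarith
      qed
      show "t 0 = tR" by (simp add: t_def T_def)
      show "t \<longlonglongrightarrow> T" unfolding t_def by real_asymp
    qed
    have "\<exists>p u. bounded_control 1 p \<and> mild_equation scl S B p T u0 u \<and> u T = e 0"
      if c: "norm (ip u0 (e 0) - 1) < r" and y: "norm (u0 - scl (ip u0 (e 0)) (e 0)) \<le> R" for u0
    proof -
      define near where "near j x \<longleftrightarrow> (j = 0 \<longrightarrow> x = S tR u0) \<and> norm (x - e 0) \<le> stage_radius (real (j0 + j))"
        for j :: nat and x
      define steered where "steered j x x' \<longleftrightarrow>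
          (\<exists>q v. bounded_control 1 q \<and> mild_equation scl S B q (t (Suc j) - t j) x v \<and> v (t (Suc j) - t j) = x')"
        for j x x'
      have "near 0 (S tR u0)"
      proof -
        have "exp (- a * tR) * norm (u0 - scl (ip u0 (e 0)) (e 0)) \<le> r"
          by (rule order_trans[OF mult_left_mono[OF y] tR(2)]) simp
        then show ?thesis
          using c free_evolution_near_ground_state[OF tR(1), of u0]
          unfolding near_def r_def by simp
      qed
      then have start: "\<exists>x. near 0 x" by blast
      have continue: "\<exists>x'. near (Suc j) x' \<and> steered j x x'" if x: "near j x" for j x
      proof -
        obtain q where q: "bounded_control 1 q"
          and q_end: "\<forall>u. mild_equation scl S B q (stage_length (real (j0 + j))) x u \<longrightarrow>
            norm (u (stage_length (real (j0 + j))) - e 0) \<le> stage_radius (real (j0 + j) + 1)"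
          using step[THEN spec, of "j0 + j"] x unfolding near_def by auto
        obtain v where v: "mild_equation scl S B q (stage_length (real (j0 + j))) x v"
          using mild_equation_exists[of "stage_length (real (j0 + j))" q 1 x] q less_imp_le[OF \<tau>_pos[of j]]
          unfolding bounded_control_def by blast
        have "near (Suc j) (v (stage_length (real (j0 + j))))"
        proof -
          have *: "real (j0 + Suc j) = real (j0 + j) + 1" by simp
          have "norm (v (stage_length (real (j0 + j))) - e 0) \<le> stage_radius (real (j0 + j) + 1)"
            using q_end v by blast
          then show ?thesis unfolding near_def * by blast
        qed
        moreover have "steered j x (v (stage_length (real (j0 + j))))"
          unfolding steered_def t_step using q v by blast
        ultimately show ?thesis by blast
      qed
      obtain w where w: "\<And>j. near j (w j)" "\<And>j. steered j (w j) (w (Suc j))"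
        using dependent_nat_choice[of near steered, OF start continue] by blast
      obtain q v where q: "\<And>j. bounded_control 1 (q j)"
        and v: "\<And>j. mild_equation scl S B (q j) (t (Suc j) - t j) (w j) (v j)"
          "\<And>j. v j (t (Suc j) - t j) = w (Suc j)"
        using w(2) unfolding steered_def by metis
      have "w \<longlonglongrightarrow> e 0"
      proof (rule Lim_null[THEN iffD2], rule Lim_null_comparison)
        show "\<forall>\<^sub>F j in sequentially. norm (w j - e 0) \<le> stage_radius (real (j0 + j))"
          using w(1) unfolding near_def by simp
        show "(\<lambda>j. stage_radius (real (j0 + j))) \<longlonglongrightarrow> 0" unfolding stage_radius_def by real_asymp
      qed
      moreover have "w 0 = S (t 0) u0" using w(1)[of 0] t(2) unfolding near_def by simp
      ultimately show ?thesis
        using steer_by_concatenation[OF t(1) _ t(3) q v] tR(1) t(2) by simp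
    qed
    moreover have "T > 0" unfolding T_def by (rule add_nonneg_pos[OF tR(1)]) (use \<open>j0 \<ge> 1\<close> in simp)
    ultimately show ?thesis by blast
  qed
  then show ?thesis using r by blast
qed

end

section \<open>From the spectral hypotheses to the controllable system\<close>

lemma sqrt_gap_iterated:
  fixes l :: "nat \<Rightarrow> real"
  assumes gap: "\<And>k. sqrt (l (Suc k)) - sqrt (l k) \<ge> \<alpha>"
  shows "sqrt (l j) + \<alpha> * real m \<le> sqrt (l (j + m))"
proof (induction m)
  case (Suc m)
  have "\<alpha> * real (Suc m) = \<alpha> * real m + \<alpha>" by (simp add: algebra_simps)
  then show ?case using Suc gap[of "j + m"] by simp
qed simp

text \<open>If x and y are the square roots of two eigenvalues that are m steps apart, then y exceeds x + \<alpha> m, so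
  the difference of their squares is at least (\<alpha> m)^2.\<close>

lemma eigenvalue_differences:
  fixes l :: "nat \<Rightarrow> real"
  assumes nonneg: "\<And>k. l k \<ge> 0" and "\<alpha> > 0"
    and gap: "\<And>k. sqrt (l (Suc k)) - sqrt (l k) \<ge> \<alpha>"
  shows "\<alpha>\<^sup>2 * (real k)\<^sup>2 \<le> l k - l 0" and "i \<noteq> k \<Longrightarrow> \<alpha>\<^sup>2 \<le> \<bar>l k - l i\<bar>"
proof -
  have diff: "(\<alpha> * real m)\<^sup>2 \<le> l (i + m) - l i" for i m
  proof -
    let ?x = "sqrt (l i)" and ?y = "sqrt (l (i + m))"
    have "?x + \<alpha> * real m \<le> ?y" by (rule sqrt_gap_iterated[of \<alpha> l, OF gap])
    moreover have "0 \<le> ?x" "0 \<le> \<alpha> * real m" using nonneg \<open>\<alpha> > 0\<close> by auto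
    ultimately have "(?x + \<alpha> * real m)\<^sup>2 \<le> ?y\<^sup>2" by (intro power_mono) auto
    moreover have "?x\<^sup>2 + (\<alpha> * real m)\<^sup>2 \<le> (?x + \<alpha> * real m)\<^sup>2"
      using mult_nonneg_nonneg[OF \<open>0 \<le> ?x\<close> \<open>0 \<le> \<alpha> * real m\<close>] by (simp add: power2_sum mult_ac)
    ultimately show ?thesis using nonneg by simp
  qed
  show "\<alpha>\<^sup>2 * (real k)\<^sup>2 \<le> l k - l 0" using diff[of k 0] by (simp add: power_mult_distrib)
  have less: "\<alpha>\<^sup>2 \<le> l k - l i" if "i < k" for i k
  proof -
    obtain m where m: "k = i + Suc m" using \<open>i < k\<close> less_iff_Suc_add by auto
    have "\<alpha> * 1 \<le> \<alpha> * real (Suc m)" using \<open>\<alpha> > 0\<close> by (intro mult_left_mono) auto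
    then have "\<alpha>\<^sup>2 \<le> (\<alpha> * real (Suc m))\<^sup>2" using \<open>\<alpha> > 0\<close> by (intro power_mono) auto
    then show ?thesis using diff[where i = i and m = "Suc m"] m by simp
  qed
  show "\<alpha>\<^sup>2 \<le> \<bar>l k - l i\<bar>" if "i \<noteq> k"
    using less[of i k] less[of k i] that by (cases i k rule: linorder_cases) auto
qed

text \<open>The power q of the eigenvalue \<mu> + \<mu>0 is replaced by an integral power n of 1 + \<mu>, using that
  \<mu> + \<mu>0 is at most (1 + \<mu>0) (1 + \<mu>).\<close>

lemma coefficient_lower_bound:
  fixes \<mu> \<mu>0 b q c :: real
  assumes "\<mu> \<ge> 0" "\<mu>0 \<ge> 0" "\<mu> + \<mu>0 > 0" "c \<ge> 0" and le: "b \<le> (\<mu> + \<mu>0) powr q * c" and n: "0 \<le> q" "q \<le> real n"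
  shows "b / (1 + \<mu>0) ^ n \<le> c * (1 + \<mu>) ^ n"
proof -
  let ?X = "(1 + \<mu>0) * (1 + \<mu>)"
  have X: "1 \<le> ?X" "\<mu> + \<mu>0 \<le> ?X"
    using assms mult_nonneg_nonneg[of \<mu>0 \<mu>] by (auto simp: algebra_simps)
  have "(\<mu> + \<mu>0) powr q \<le> ?X powr q"
    using assms X by (intro powr_mono2) auto
  also have "\<dots> \<le> ?X powr real n" using n X by (intro powr_mono) auto
  also have "\<dots> = ?X ^ n" using X by (simp add: powr_realpow)
  finally have "b \<le> ?X ^ n * c" using le mult_right_mono[OF _ \<open>c \<ge> 0\<close>] order_trans by blast
  then have "b \<le> c * (1 + \<mu>) ^ n * (1 + \<mu>0) ^ n"
    by (simp only: power_mult_distrib mult_ac)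
  then show ?thesis using \<open>\<mu>0 \<ge> 0\<close> by (simp add: pos_divide_le_eq)
qed

lemma (in separable_hilbert_space) square_integrable_bounded_control:
  assumes "bounded_control P p" shows "square_integrable_on K T p"
proof -
  have p: "\<And>s. p s \<in> K" "\<And>s. norm (p s) \<le> P" and [measurable]: "p \<in> borel_measurable borel"
    using assms unfolding bounded_control_def by auto
  have "set_integrable lborel {0<..<T} (\<lambda>t. (norm (p t))\<^sup>2)"
    unfolding set_integrable_def
  proof (rule integrableI_bounded_set_indicator[where B = "P\<^sup>2"])
    show "emeasure lborel {0<..<T} < \<infinity>"
      by (cases "0 \<le> T") (auto simp: less_top[symmetric])
    show "AE t in lborel. t \<in> {0<..<T} \<longrightarrow> norm ((norm (p t))\<^sup>2) \<le> P\<^sup>2"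
      using p(2) by (auto intro!: power_mono)
  qed auto
  moreover have "set_borel_measurable lborel {0<..<T} p"
    unfolding set_borel_measurable_def by measurable
  ultimately show ?thesis unfolding square_integrable_on_def using p(1) by blast
qed

theorem theorem1p2:
  fixes K :: "complex set"
    and scl :: "complex \<Rightarrow> 'a::{real_inner, banach, second_countable_topology} \<Rightarrow> 'a"
    and ip :: "'a \<Rightarrow> 'a \<Rightarrow> complex"
    and D :: "'a set" and A B :: "'a \<Rightarrow> 'a"
    and lam :: "nat \<Rightarrow> real" and \<phi> :: "nat \<Rightarrow> 'a"
    and \<alpha> b q :: real
  assumes "separable_hilbert_space K scl ip"
    and "linear_operator_on K scl D A" and "densely_defined D"
    and "self_adjoint ip D A"
    and "accretive ip D A"
    and "has_compact_resolvent K scl D A"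
    and "orthonormal_basis scl ip \<phi> {1..}"
    and "\<forall>k\<ge>1. \<phi> k \<in> D \<and> A (\<phi> k) = lam k *\<^sub>R \<phi> k"
    and "mono_on {1..} lam"
    and "\<alpha> > 0" and "\<forall>k\<ge>1. sqrt (lam (k + 1)) - sqrt (lam k) \<ge> \<alpha>"
    and "bounded_operator K scl B"
    and "b > 0" and "q > 0"
    and "ip (B (\<phi> 1)) (\<phi> 1) \<noteq> 0"
    and "\<forall>k>1. lam k powr q * norm (ip (B (\<phi> 1)) (\<phi> k)) \<ge> b"
  shows "\<exists>r1>0. \<forall>R>0. \<exists>T>0. \<forall>u0.
    norm (ip u0 (\<phi> 1) - 1) < r1 \<and> norm (u0 - scl (ip u0 (\<phi> 1)) (\<phi> 1)) \<le> R \<longrightarrow>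
    (\<exists>p u. square_integrable_on K T p \<and>
       mild_solution scl (exp_neg K scl D A) B p T u0 u \<and>
       u T = ground_state lam \<phi> T)"
proof -
  define e where "e k = \<phi> (Suc k)" for k
  define l where "l k = lam (Suc k)" for k
  define \<mu> where "\<mu> k = l k - l 0" for k
  interpret separable_hilbert_space K scl ip by fact
  interpret hilbert_basis K scl ip e
  proof
    show "ip (e j) (e k) = (if j = k then 1 else 0)" for j k
      using assms(7) unfolding orthonormal_basis_def e_def by simp
    show "(\<lambda>k. scl (ip x (e k)) (e k)) sums x" for x
    proof -
      have "{1..} = range Suc" by (auto simp: image_iff Suc_le_eq gr0_conv_Suc)
      then have "((\<lambda>k. scl (ip x (\<phi> k)) (\<phi> k)) has_sum x) (range Suc)"
        using assms(7) unfolding orthonormal_basis_def by simp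
      then have "((\<lambda>k. scl (ip x (e k)) (e k)) has_sum x) UNIV"
        unfolding e_def by (subst (asm) has_sum_reindex) (auto simp: comp_def)
      then show ?thesis by (rule has_sum_imp_sums)
    qed
  qed
  have eig: "e k \<in> D \<and> A (e k) = l k *\<^sub>R e k" for k
    using assms(8) unfolding e_def l_def by simp
  have l_nonneg: "l k \<ge> 0" for k
  proof -
    have "ip (A (e k)) (e k) = of_real (l k)" using eig[of k] by (simp add: ip_scaleR_left orthonormal)
    then show ?thesis using \<open>accretive ip D A\<close> eig[of k] unfolding accretive_def by (metis nonneg_Reals_of_real_iff)
  qed
  have l_gap: "sqrt (l (Suc k)) - sqrt (l k) \<ge> \<alpha>" for k
    using assms(11) unfolding l_def by simp
  note l_diff = eigenvalue_differences[of l, OF l_nonneg \<open>\<alpha> > 0\<close> l_gap]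
  have \<mu>_nonneg: "\<mu> k \<ge> 0" for k
    using l_diff(1)[of k] unfolding \<mu>_def by (meson mult_nonneg_nonneg order_trans zero_le_power2)
  have l_eq: "l = (\<lambda>k. \<mu> k + l 0)" by (simp add: \<mu>_def)
  have B: "bounded_linear B" using assms(12) unfolding bounded_operator_def by blast
  obtain c where c: "c > 0" "\<And>x. norm (B x) \<le> c * norm x"
    using bounded_linear.pos_bounded[OF B] by (metis mult.commute)
  define n where "n = nat \<lceil>q\<rceil>"
  have n: "q \<le> real n" unfolding n_def by linarith
  define \<beta> where "\<beta> = min (norm (ip (B (e 0)) (e 0))) (b / (1 + l 0) ^ n)"
  have \<beta>: "\<beta> > 0"
    unfolding \<beta>_def e_def using assms(15) \<open>b > 0\<close> l_nonneg[of 0] by simp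
  have spread: "\<beta> \<le> norm (ip (B (e 0)) (e k)) * (1 + \<mu> k) ^ n" for k
  proof (cases "k = 0")
    case True
    then show ?thesis by (simp add: \<beta>_def \<mu>_def)
  next
    case False
    have "\<alpha>\<^sup>2 * (real k)\<^sup>2 > 0" using False \<open>\<alpha> > 0\<close> by simp
    then have "l k > 0" using l_diff(1)[of k] l_nonneg[of 0] by linarith
    then have "b / (1 + l 0) ^ n \<le> norm (ip (B (e 0)) (e k)) * (1 + \<mu> k) ^ n"
      using assms(16) False \<open>q > 0\<close> n \<mu>_nonneg l_nonneg
      by (intro coefficient_lower_bound[where q = q]) (auto simp: \<mu>_def l_def e_def)
    then show ?thesis unfolding \<beta>_def by linarith
  qed
  interpret shifted: controllable_system K scl ip e \<mu> B c "\<alpha>\<^sup>2" "\<alpha>\<^sup>2" \<beta> n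
    by (intro controllable_system.intro controllable_system_axioms.intro
          bilinear_system.intro bilinear_system_axioms.intro hilbert_basis_axioms)
       (use \<mu>_nonneg B c l_diff spread \<beta> \<open>\<alpha> > 0\<close> in \<open>auto simp: \<mu>_def\<close>)
  interpret original: bilinear_system K scl ip e l B c
    by (intro bilinear_system.intro bilinear_system_axioms.intro hilbert_basis_axioms)
       (use l_nonneg B c in auto)
  have exp_neg: "exp_neg K scl D A t x = semigroup l t x" if "t \<ge> 0" for t x
    by (rule exp_neg_eq_semigroup[of l, OF l_nonneg \<open>self_adjoint ip D A\<close> eig that])
  \<comment> \<open>Multiplication by exp(-lam 1 t) carries solutions for the shifted rates that end in the first
    eigenvector to solutions of the original equation that end in the ground state.\<close>
  have transfer: "\<exists>p u. square_integrable_on K T p \<and> mild_solution scl (exp_neg K scl D A) B p T u0 u \<and>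
      u T = ground_state lam \<phi> T"
    if p: "bounded_control 1 p" and w: "mild_equation scl (semigroup \<mu>) B p T u0 w" "w T = e 0" for p w T u0
  proof -
    have pK: "p s \<in> K" "norm (p s) \<le> 1" for s using p unfolding bounded_control_def by auto
    define u where "u t = exp (- l 0 * t) *\<^sub>R w t" for t
    have u: "mild_equation scl (semigroup l) B p T u0 u"
      using mild_equation_shift_rates[of \<mu> "l 0", OF \<mu>_nonneg l_nonneg B pK(1) w(1)]
      unfolding u_def l_eq[symmetric] .
    have "mild_equation scl (exp_neg K scl D A) B p T u0 u"
      using u by (rule mild_equation_cong[rotated -1]) (auto simp: exp_neg)
    moreover have "v t = u t" if v: "mild_equation scl (exp_neg K scl D A) B p T u0 v" and "t \<in> {0..T}" for v t
    proof -
      have "mild_equation scl (semigroup l) B p T u0 v"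
        using v by (rule mild_equation_cong[rotated -1]) (auto simp: exp_neg)
      from original.mild_equation_unique[OF pK this u \<open>t \<in> {0..T}\<close>] show ?thesis .
    qed
    ultimately have "mild_solution scl (exp_neg K scl D A) B p T u0 u"
      unfolding mild_solution_def by blast
    moreover have "u T = ground_state lam \<phi> T"
      unfolding u_def w(2) ground_state_def by (simp add: e_def l_def)
    ultimately show ?thesis using square_integrable_bounded_control[OF p] by blast
  qed
  have "e 0 = \<phi> 1" by (simp add: e_def)
  then show ?thesis
    using shifted.controllable_to_ground_state transfer by metis
qed

end
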